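(* Let $C_1,\dots,C_n$ be independent first class constraints on $\mathcal{M}$, let $T_1,\dots,T_n,f\in C^\infty(\mathcal{M})$, let $x\in\mathcal{C}$, and assume that $\mathbf{T}_x:\mathcal{G}_x\to\mathbb{R}^n$, $y\mapsto(T_1(y),\dots,T_n(y))$, is injective on the gauge orbit $\mathcal{G}_x$. Let $\tau\in\mathbf{T}_x(\mathcal{G}_x)$ and $\gamma\in\mathbb{R}^n$. Then $$F_{[\alpha_{\gamma_jC_j}(f);T_i]}(\tau;x)=F_{[f;\alpha_{-\gamma_jC_j}(T_i)]}(\tau;x)=F_{[f;T_i]}(\tau';x),\qquad \tau'_i:=T_i\big(\alpha_{\gamma_jC_j}(\mathbf{T}_x^{-1}(\tau))\big).$$ If moreover the matrix $A_{jk}=\{C_j,T_k\}$ is invertible on a neighbourhood of $\mathcal{C}$ and $\tilde C_m:=\sum_jA^{-1}_{mj}C_j$, then $$F_{[\alpha_{\gamma_j\tilde C_j}(f);T_i]}(\tau;x)=F_{[f;T_i]}(\tau_1+\gamma_1,\dots,\tau_n+\gamma_n;x).$$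
   Context: $\mathcal{M}$ is a $2p$-dimensional smooth manifold with a non-degenerate Poisson bracket $\{\cdot,\cdot\}$. The constraints $C_1,\dots,C_n\in C^\infty(\mathcal{M})$, $n<p$, are independent, meaning that the constraint hypersurface $\mathcal{C}=\{C_1=\dots=C_n=0\}$ is a $(2p-n)$-dimensional submanifold, and first class: $\{C_i,C_j\}=\sum_k f_{ijk}C_k$ with $f_{ijk}\in C^\infty(\mathcal{M})$. For a function $H$ the Hamiltonian vector field is $\chi_H(f)=\{H,f\}$ with flow $\alpha^t_H$; $\alpha_{\gamma_jC_j}$ denotes the flow of $\sum_j\gamma_jC_j$ at $t=1$ (similarly for $\tilde C_j$), acting on functions by $\alpha(f)(x)=f(\alpha(x))$. All flows used are assumed to be defined. The gauge orbit $\mathcal{G}_x$ of $x\in\mathcal{C}$ is the set of points reached from $x$ by finite compositions of flows generated by the constraints; on $\mathcal{C}$ the sets $\{C_j\}$ and $\{\tilde C_j\}$ generate the same gauge orbits. For functions $f,T'_1,\dots,T'_n$, the complete observable $F_{[f;T'_i]}(\tau;x)$ is the value of $f$ at the point $z\in\mathcal{G}_x$ with $T'_i(z)=\tau_i$ for $i=1,\dots,n$ (defined when such a point exists and is unique). $\mathbf{T}_x^{-1}(\tau)$ is the unique $y\in\mathcal{G}_x$ with $T_i(y)=\tau_i$ for all $i$. *)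

theory Defs
  imports "HOL-Analysis.Analysis"
begin

section \<open>Smooth maps between Euclidean spaces\<close>

fun differentiable_times_on ::
  "nat \<Rightarrow> 'a::euclidean_space set \<Rightarrow> ('a \<Rightarrow> 'b::real_normed_vector) \<Rightarrow> bool" where
  "differentiable_times_on 0 S f \<longleftrightarrow> continuous_on S f"
| "differentiable_times_on (Suc k) S f \<longleftrightarrow>
     (\<forall>u\<in>S. f differentiable (at u)) \<and>
     (\<forall>v. differentiable_times_on k S (\<lambda>u. frechet_derivative f (at u) v))"

text \<open>Only used for open sets \<open>S\<close>.\<close>

definition smooth_on :: "'a::euclidean_space set \<Rightarrow> ('a \<Rightarrow> 'b::real_normed_vector) \<Rightarrow> bool" where
  "smooth_on S f \<longleftrightarrow> (\<forall>k. differentiable_times_on k S f)"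


section \<open>Smooth manifolds\<close>

text \<open>
  The manifold is the whole of a type \<open>'m\<close>, whose topology is assumed Hausdorff and second
  countable in the main theorem; its smooth structure is given by an atlas with values in a
  Euclidean space \<open>'e\<close>, so that the dimension is \<open>DIM('e)\<close>. A chart is a pair of an open domain
  and a coordinate map, of which only the values on the domain matter.
\<close>

type_synonym ('m, 'e) chart = "'m set \<times> ('m \<Rightarrow> 'e)"

definition is_chart :: "('m::topological_space, 'e::euclidean_space) chart \<Rightarrow> bool" where
  "is_chart c \<longleftrightarrow> (case c of (U, \<phi>) \<Rightarrow>
     open U \<and> open (\<phi> ` U) \<and> homeomorphism U (\<phi> ` U) \<phi> (inv_into U \<phi>))"

definition smooth_transition ::
  "('m::topological_space, 'e::euclidean_space) chart \<Rightarrow> ('m, 'e) chart \<Rightarrow> bool" where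
  "smooth_transition c d \<longleftrightarrow> (case c of (U, \<phi>) \<Rightarrow> case d of (V, \<psi>) \<Rightarrow>
     smooth_on (\<phi> ` (U \<inter> V)) (\<psi> \<circ> inv_into U \<phi>))"

definition smooth_atlas :: "('m::topological_space, 'e::euclidean_space) chart set \<Rightarrow> bool" where
  "smooth_atlas atl \<longleftrightarrow>
     (\<forall>c\<in>atl. is_chart c) \<and> (\<Union>c\<in>atl. fst c) = UNIV \<and>
     (\<forall>c\<in>atl. \<forall>d\<in>atl. smooth_transition c d)"

text \<open>Charts of the maximal atlas.\<close>

definition compatible_chart ::
  "('m::topological_space, 'e::euclidean_space) chart set \<Rightarrow> ('m, 'e) chart \<Rightarrow> bool" where
  "compatible_chart atl c \<longleftrightarrow>
     is_chart c \<and> (\<forall>d\<in>atl. smooth_transition c d \<and> smooth_transition d c)"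

definition smooth_fun ::
  "('m::topological_space, 'e::euclidean_space) chart set \<Rightarrow> ('m \<Rightarrow> real) \<Rightarrow> bool" where
  "smooth_fun atl f \<longleftrightarrow> (\<forall>(U, \<phi>)\<in>atl. smooth_on (\<phi> ` U) (f \<circ> inv_into U \<phi>))"

definition differential_zero_at ::
  "('m::topological_space, 'e::euclidean_space) chart set \<Rightarrow> ('m \<Rightarrow> real) \<Rightarrow> 'm \<Rightarrow> bool" where
  "differential_zero_at atl f y \<longleftrightarrow>
     (\<forall>(U, \<phi>)\<in>atl. y \<in> U \<longrightarrow> ((f \<circ> inv_into U \<phi>) has_derivative (\<lambda>v. 0)) (at (\<phi> y)))"

text \<open>Embedded submanifolds of dimension \<open>k\<close>, by slice charts.\<close>

definition submanifold ::
  "('m::topological_space, 'e::euclidean_space) chart set \<Rightarrow> nat \<Rightarrow> 'm set \<Rightarrow> bool" where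
  "submanifold atl k S \<longleftrightarrow>
     (\<forall>y\<in>S. \<exists>U \<phi> L. compatible_chart atl (U, \<phi>) \<and> y \<in> U \<and>
        subspace L \<and> dim L = k \<and> \<phi> ` (U \<inter> S) = \<phi> ` U \<inter> L)"


section \<open>Poisson brackets and Hamiltonian flows\<close>

text \<open>A bracket is a function on all real functions, but only its values on smooth functions
  are constrained.\<close>

type_synonym 'm bracket = "('m \<Rightarrow> real) \<Rightarrow> ('m \<Rightarrow> real) \<Rightarrow> 'm \<Rightarrow> real"

definition poisson_bracket ::
  "('m::topological_space, 'e::euclidean_space) chart set \<Rightarrow> 'm bracket \<Rightarrow> bool" where
  "poisson_bracket atl pb \<longleftrightarrow>
     (\<forall>f g. smooth_fun atl f \<and> smooth_fun atl g \<longrightarrow>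
        smooth_fun atl (pb f g) \<and> (\<forall>y. pb f g y = - pb g f y)) \<and>
     (\<forall>f g h. smooth_fun atl f \<and> smooth_fun atl g \<and> smooth_fun atl h \<longrightarrow>
        (\<forall>a b y. pb (\<lambda>z. a * f z + b * g z) h y = a * pb f h y + b * pb g h y) \<and>
        (\<forall>y. pb f (\<lambda>z. g z * h z) y = pb f g y * h y + g y * pb f h y) \<and>
        (\<forall>y. pb f (pb g h) y + pb g (pb h f) y + pb h (pb f g) y = 0))"

definition nondegenerate ::
  "('m::topological_space, 'e::euclidean_space) chart set \<Rightarrow> 'm bracket \<Rightarrow> bool" where
  "nondegenerate atl pb \<longleftrightarrow>
     (\<forall>f y. smooth_fun atl f \<and> (\<forall>g. smooth_fun atl g \<longrightarrow> pb f g y = 0)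
        \<longrightarrow> differential_zero_at atl f y)"

text \<open>
  Integral curves of the Hamiltonian vector field \<open>\<chi>\<^sub>H(f) = {H, f}\<close>. The generator \<open>H\<close> need only be
  smooth near the curve (the modified constraints are smooth only near the constraint surface):
  as a Poisson bracket is local, \<open>{H, f}\<close> at a point is the bracket with any globally smooth
  function \<open>h\<close> that agrees with \<open>H\<close> near that point; if \<open>H\<close> is smooth, \<open>h = H\<close> will do.
\<close>

definition integral_curve ::
  "('m::topological_space, 'e::euclidean_space) chart set \<Rightarrow> 'm bracket \<Rightarrow> ('m \<Rightarrow> real) \<Rightarrow>
   real set \<Rightarrow> (real \<Rightarrow> 'm) \<Rightarrow> bool" where
  "integral_curve atl pb H I c \<longleftrightarrow>
     continuous_on I c \<and>
     (\<forall>t\<in>I. \<exists>h. smooth_fun atl h \<and> (\<forall>\<^sub>F y in nhds (c t). h y = H y) \<and>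
        (\<forall>f. smooth_fun atl f \<longrightarrow> ((\<lambda>s. f (c s)) has_real_derivative pb h f (c t)) (at t)))"

definition flows_to ::
  "('m::topological_space, 'e::euclidean_space) chart set \<Rightarrow> 'm bracket \<Rightarrow> ('m \<Rightarrow> real) \<Rightarrow>
   real \<Rightarrow> 'm \<Rightarrow> 'm \<Rightarrow> bool" where
  "flows_to atl pb H t y z \<longleftrightarrow>
     (\<exists>I c. open I \<and> is_interval I \<and> 0 \<in> I \<and> t \<in> I \<and>
        integral_curve atl pb H I c \<and> c 0 = y \<and> c t = z)"

definition flow_defined ::
  "('m::topological_space, 'e::euclidean_space) chart set \<Rightarrow> 'm bracket \<Rightarrow> ('m \<Rightarrow> real) \<Rightarrow>
   real \<Rightarrow> 'm \<Rightarrow> bool" where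
  "flow_defined atl pb H t y \<longleftrightarrow> (\<exists>z. flows_to atl pb H t y z)"

definition ham_flow ::
  "('m::topological_space, 'e::euclidean_space) chart set \<Rightarrow> 'm bracket \<Rightarrow> ('m \<Rightarrow> real) \<Rightarrow>
   real \<Rightarrow> 'm \<Rightarrow> 'm" where
  "ham_flow atl pb H t y = (THE z. flows_to atl pb H t y z)"

text \<open>The action \<open>\<alpha>\<^sub>H(f)(y) = f(\<alpha>\<^sub>H(y))\<close> of the flow at time \<open>1\<close> on functions.\<close>

definition flow_act ::
  "('m::topological_space, 'e::euclidean_space) chart set \<Rightarrow> 'm bracket \<Rightarrow> ('m \<Rightarrow> real) \<Rightarrow>
   ('m \<Rightarrow> real) \<Rightarrow> 'm \<Rightarrow> real" where
  "flow_act atl pb H f y = f (ham_flow atl pb H 1 y)"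


section \<open>Constraints, gauge orbits and complete observables\<close>

definition constraint_surface :: "('n \<Rightarrow> 'm \<Rightarrow> real) \<Rightarrow> 'm set" where
  "constraint_surface C = {y. \<forall>i. C i y = 0}"

definition independent_constraints ::
  "('m::topological_space, 'e::euclidean_space) chart set \<Rightarrow> ('n::finite \<Rightarrow> 'm \<Rightarrow> real) \<Rightarrow> bool" where
  "independent_constraints atl C \<longleftrightarrow>
     submanifold atl (DIM('e) - CARD('n)) (constraint_surface C)"

definition first_class ::
  "('m::topological_space, 'e::euclidean_space) chart set \<Rightarrow> 'm bracket \<Rightarrow>
   ('n::finite \<Rightarrow> 'm \<Rightarrow> real) \<Rightarrow> bool" where
  "first_class atl pb C \<longleftrightarrow>
     (\<exists>F :: 'n \<Rightarrow> 'n \<Rightarrow> 'n \<Rightarrow> 'm \<Rightarrow> real. (\<forall>i j k. smooth_fun atl (F i j k)) \<and>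
        (\<forall>i j y. pb (C i) (C j) y = (\<Sum>k\<in>UNIV. F i j k y * C k y)))"

definition constraint_comb :: "real^'n \<Rightarrow> ('n::finite \<Rightarrow> 'm \<Rightarrow> real) \<Rightarrow> 'm \<Rightarrow> real" where
  "constraint_comb \<gamma> C y = (\<Sum>j\<in>UNIV. \<gamma> $ j * C j y)"

text \<open>
  The flows generated by the constraints are those of their linear combinations with constant
  coefficients, i.e. the gauge transformations \<open>\<alpha>\<^bsub>\<gamma>\<^sub>jC\<^sub>j\<^esub>\<close>; unit vectors \<open>\<gamma>\<close> give the flows of the
  individual constraints.
\<close>

inductive_set gauge_orbit ::
  "('m::topological_space, 'e::euclidean_space) chart set \<Rightarrow> 'm bracket \<Rightarrow>
   ('n::finite \<Rightarrow> 'm \<Rightarrow> real) \<Rightarrow> 'm \<Rightarrow> 'm set"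
  for atl pb C x where
  start: "x \<in> gauge_orbit atl pb C x"
| flow: "y \<in> gauge_orbit atl pb C x \<Longrightarrow> flows_to atl pb (constraint_comb \<gamma> C) t y z
    \<Longrightarrow> z \<in> gauge_orbit atl pb C x"

definition clock_map :: "('n::finite \<Rightarrow> 'm \<Rightarrow> real) \<Rightarrow> 'm \<Rightarrow> real^'n" where
  "clock_map T y = (\<chi> i. T i y)"

definition clock_map_inv ::
  "('m::topological_space, 'e::euclidean_space) chart set \<Rightarrow> 'm bracket \<Rightarrow>
   ('n::finite \<Rightarrow> 'm \<Rightarrow> real) \<Rightarrow> ('n \<Rightarrow> 'm \<Rightarrow> real) \<Rightarrow> 'm \<Rightarrow> real^'n \<Rightarrow> 'm" where
  "clock_map_inv atl pb C T x \<tau> = (THE y. y \<in> gauge_orbit atl pb C x \<and> clock_map T y = \<tau>)"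

definition complete_observable_defined ::
  "('m::topological_space, 'e::euclidean_space) chart set \<Rightarrow> 'm bracket \<Rightarrow>
   ('n::finite \<Rightarrow> 'm \<Rightarrow> real) \<Rightarrow> ('n \<Rightarrow> 'm \<Rightarrow> real) \<Rightarrow> real^'n \<Rightarrow> 'm \<Rightarrow> bool" where
  "complete_observable_defined atl pb C T \<tau> x \<longleftrightarrow>
     (\<exists>!z. z \<in> gauge_orbit atl pb C x \<and> (\<forall>i. T i z = \<tau> $ i))"

definition complete_observable ::
  "('m::topological_space, 'e::euclidean_space) chart set \<Rightarrow> 'm bracket \<Rightarrow>
   ('n::finite \<Rightarrow> 'm \<Rightarrow> real) \<Rightarrow> ('m \<Rightarrow> real) \<Rightarrow> ('n \<Rightarrow> 'm \<Rightarrow> real) \<Rightarrow> real^'n \<Rightarrow> 'm \<Rightarrow> real" where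
  "complete_observable atl pb C f T \<tau> x =
     f (THE z. z \<in> gauge_orbit atl pb C x \<and> (\<forall>i. T i z = \<tau> $ i))"

definition clock_matrix ::
  "'m bracket \<Rightarrow> ('n::finite \<Rightarrow> 'm \<Rightarrow> real) \<Rightarrow> ('n \<Rightarrow> 'm \<Rightarrow> real) \<Rightarrow> 'm \<Rightarrow> real^'n^'n" where
  "clock_matrix pb C T y = (\<chi> j k. pb (C j) (T k) y)"

text \<open>Meaningful only where \<open>clock_matrix\<close> is invertible.\<close>

definition modified_constraint ::
  "'m bracket \<Rightarrow> ('n::finite \<Rightarrow> 'm \<Rightarrow> real) \<Rightarrow> ('n \<Rightarrow> 'm \<Rightarrow> real) \<Rightarrow> 'n \<Rightarrow> 'm \<Rightarrow> real" where
  "modified_constraint pb C T m y =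
     (\<Sum>j\<in>UNIV. matrix_inv (clock_matrix pb C T y) $ m $ j * C j y)"

end

theory Submission
  imports Defs
begin

text \<open>
  The first chain of equalities is formal once flows are functions: the flow of \<open>\<gamma>\<^sub>jC\<^sub>j\<close> permutes the
  gauge orbit with inverse the flow of \<open>-\<gamma>\<^sub>jC\<^sub>j\<close>, so all three observables take the value of \<open>f\<close> at
  the image of \<open>T\<^sub>x\<^sup>-\<^sup>1(\<tau>)\<close>. Integral curves are only tested against globally smooth functions;
  multiplying chart coordinates with a bump function gives enough of these both to show that the
  bracket is local and to reduce uniqueness of integral curves to Gronwall's inequality.
  For the modified constraints, \<open>{\<gamma>\<^sub>m C'\<^sub>m, T\<^sub>i} = \<gamma>\<^sub>i\<close> on the constraint surface, which contains the
  gauge orbit by first-classness (Gronwall again); hence their flow shifts the clocks by \<open>\<gamma>\<close>.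
\<close>

section \<open>Calculus of smooth functions\<close>

text \<open>Openness is what makes this work: the derivative at a point of \<open>S\<close> depends
  only on values inside \<open>S\<close>, so both functions have the same directional derivatives
  there and the induction continues with those.\<close>

lemma differentiable_times_on_cong:
  assumes "open S" "\<And>u. u \<in> S \<Longrightarrow> f u = g u" "differentiable_times_on k S f"
  shows "differentiable_times_on k S g"
  using assms(2,3)
proof (induction k arbitrary: f g)
  case 0
  then show ?case by (simp cong: continuous_on_cong)
next
  case (Suc k)
  have D: "(g has_derivative frechet_derivative f (at u)) (at u)" if "u \<in> S" for u
  proof (rule has_derivative_transform_within_open[OF _ assms(1) that])
    show "(f has_derivative frechet_derivative f (at u)) (at u)"
      using Suc.prems that by (simp flip: frechet_derivative_works)
  qed (use Suc.prems in auto)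
  then have eq: "frechet_derivative f (at u) = frechet_derivative g (at u)" if "u \<in> S" for u
    using frechet_derivative_at that by blast
  have "differentiable_times_on k S (\<lambda>u. frechet_derivative g (at u) v)" for v
    by (rule Suc.IH[of "\<lambda>u. frechet_derivative f (at u) v"]) (use Suc.prems eq in auto)
  then show ?case
    using D by (auto simp: differentiable_def)
qed

text \<open>Introduction rule for the closure lemmas that follow: an explicit derivative
  \<open>D\<close> may stand in for \<open>frechet_derivative\<close>, since derivatives are
  unique.\<close>

lemma differentiable_times_on_Suc:
  assumes "open S" "\<And>u. u \<in> S \<Longrightarrow> (f has_derivative D u) (at u)"
    and "\<And>v. differentiable_times_on k S (\<lambda>u. D u v)"
  shows "differentiable_times_on (Suc k) S f"
proof -
  have "D u = frechet_derivative f (at u)" if "u \<in> S" for u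
    using frechet_derivative_at assms(2)[OF that] by blast
  then have "differentiable_times_on k S (\<lambda>u. frechet_derivative f (at u) v)" for v
    by (intro differentiable_times_on_cong[OF assms(1) _ assms(3)[of v]]) auto
  then show ?thesis
    using assms(2) by (auto simp: differentiable_def)
qed

text \<open>Needed for the product rule, where factors that were not differentiated must be regular
  to the lower order as well.\<close>

lemma differentiable_times_on_SucD:
  "differentiable_times_on (Suc k) S f \<Longrightarrow> differentiable_times_on k S f"
proof (induction k arbitrary: f)
  case 0
  then show ?case
    by (auto intro!: continuous_at_imp_continuous_on differentiable_imp_continuous_within)
next
  case (Suc k)
  from Suc.prems have "differentiable_times_on (Suc k) S (\<lambda>u. frechet_derivative f (at u) v)" for v
    by simp
  then have "differentiable_times_on k S (\<lambda>u. frechet_derivative f (at u) v)" for v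
    by (rule Suc.IH)
  then show ?case using Suc.prems by simp
qed

lemma differentiable_times_on_const:
  "open S \<Longrightarrow> differentiable_times_on k S (\<lambda>u. c)"
proof (induction k arbitrary: c)
  case (Suc k)
  show ?case
    by (rule differentiable_times_on_Suc[where D="\<lambda>u v. 0"]) (use Suc in auto)
qed simp

lemma differentiable_times_on_add:
  "open S \<Longrightarrow> differentiable_times_on k S f \<Longrightarrow> differentiable_times_on k S g \<Longrightarrow>
    differentiable_times_on k S (\<lambda>u. f u + g u)"
proof (induction k arbitrary: f g)
  case (Suc k)
  show ?case
    by (rule differentiable_times_on_Suc[where
          D="\<lambda>u v. frechet_derivative f (at u) v + frechet_derivative g (at u) v"])
      (use Suc in \<open>auto intro!: has_derivative_add simp flip: frechet_derivative_works\<close>)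
qed (auto intro: continuous_on_add)

lemma differentiable_times_on_mult:
  fixes f g :: "'a::euclidean_space \<Rightarrow> real"
  shows "open S \<Longrightarrow> differentiable_times_on k S f \<Longrightarrow> differentiable_times_on k S g \<Longrightarrow>
    differentiable_times_on k S (\<lambda>u. f u * g u)"
proof (induction k arbitrary: f g)
  case (Suc k)
  have "differentiable_times_on k S f" "differentiable_times_on k S g"
    using Suc.prems differentiable_times_on_SucD by blast+
  then show ?case
    by (intro differentiable_times_on_Suc[where
          D="\<lambda>u v. f u * frechet_derivative g (at u) v + frechet_derivative f (at u) v * g u"])
      (use Suc in \<open>auto intro!: differentiable_times_on_add has_derivative_mult
         simp flip: frechet_derivative_works\<close>)
qed (auto intro: continuous_on_mult)

lemma differentiable_times_on_inner:
  "open S \<Longrightarrow> differentiable_times_on k S f \<Longrightarrow> differentiable_times_on k S (\<lambda>u. f u \<bullet> b)"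
proof (induction k arbitrary: f)
  case (Suc k)
  show ?case
    by (rule differentiable_times_on_Suc[where D="\<lambda>u v. frechet_derivative f (at u) v \<bullet> b"])
      (use Suc in \<open>auto intro!: has_derivative_inner_left simp flip: frechet_derivative_works\<close>)
qed (auto intro!: continuous_intros)

lemma smooth_on_cong:
  "smooth_on S f \<Longrightarrow> open S \<Longrightarrow> (\<And>u. u \<in> S \<Longrightarrow> f u = g u) \<Longrightarrow> smooth_on S g"
  unfolding smooth_on_def by (blast intro: differentiable_times_on_cong)

lemma smooth_on_const: "open S \<Longrightarrow> smooth_on S (\<lambda>u. c)"
  by (simp add: smooth_on_def differentiable_times_on_const)

lemma smooth_on_add:
  "open S \<Longrightarrow> smooth_on S f \<Longrightarrow> smooth_on S g \<Longrightarrow> smooth_on S (\<lambda>u. f u + g u)"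
  by (simp add: smooth_on_def differentiable_times_on_add)

lemma smooth_on_mult:
  fixes f g :: "'a::euclidean_space \<Rightarrow> real"
  shows "open S \<Longrightarrow> smooth_on S f \<Longrightarrow> smooth_on S g \<Longrightarrow> smooth_on S (\<lambda>u. f u * g u)"
  by (simp add: smooth_on_def differentiable_times_on_mult)

lemma differentiable_times_on_sum:
  "open S \<Longrightarrow> (\<And>i. i \<in> I \<Longrightarrow> differentiable_times_on k S (f i)) \<Longrightarrow>
    differentiable_times_on k S (\<lambda>u. \<Sum>i\<in>I. f i u)"
  by (induction I rule: infinite_finite_induct)
    (auto intro: differentiable_times_on_add differentiable_times_on_const)

lemma smooth_on_sum:
  "open S \<Longrightarrow> (\<And>i. i \<in> I \<Longrightarrow> smooth_on S (f i)) \<Longrightarrow> smooth_on S (\<lambda>u. \<Sum>i\<in>I. f i u)"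
  by (simp add: smooth_on_def differentiable_times_on_sum)

lemma smooth_on_inner_left:
  fixes b :: "'a::euclidean_space"
  assumes "open S"
  shows "smooth_on S (\<lambda>u. u \<bullet> b)"
proof -
  have "differentiable_times_on k S (\<lambda>u. u \<bullet> b)" for k
  proof (cases k)
    case (Suc n)
    have "differentiable_times_on (Suc n) S (\<lambda>u. u \<bullet> b)"
      by (rule differentiable_times_on_Suc[where D="\<lambda>u v. v \<bullet> b"])
        (auto intro!: derivative_eq_intros differentiable_times_on_const assms)
    with Suc show ?thesis by simp
  qed (auto intro!: continuous_intros)
  then show ?thesis by (simp add: smooth_on_def)
qed

lemma smooth_on_subset: "smooth_on S f \<Longrightarrow> S' \<subseteq> S \<Longrightarrow> smooth_on S' f"
proof -
  have "differentiable_times_on k S f \<Longrightarrow> S' \<subseteq> S \<Longrightarrow> differentiable_times_on k S' f" for k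
    by (induction k arbitrary: f) (auto intro: continuous_on_subset)
  then show "smooth_on S f \<Longrightarrow> S' \<subseteq> S \<Longrightarrow> smooth_on S' f" by (simp add: smooth_on_def)
qed

lemma smooth_on_Un:
  assumes "open S" "open S'" "smooth_on S f" "smooth_on S' f"
  shows "smooth_on (S \<union> S') f"
proof -
  have "differentiable_times_on k S f \<Longrightarrow> differentiable_times_on k S' f \<Longrightarrow>
      differentiable_times_on k (S \<union> S') f" for k
    by (induction k arbitrary: f) (use assms in \<open>auto intro: continuous_on_open_Un\<close>)
  then show ?thesis using assms by (simp add: smooth_on_def)
qed

text \<open>Chain rule by induction on the order, for all \<open>f\<close> at once, because the
  induction hypothesis is applied to directional derivatives of \<open>f\<close>.\<close>

lemma smooth_on_compose:
  fixes f :: "'b::euclidean_space \<Rightarrow> real" and w :: "'a::euclidean_space \<Rightarrow> 'b"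
  assumes "open S" "open S'" "smooth_on S w" "w ` S \<subseteq> S'" "smooth_on S' f"
  shows "smooth_on S (\<lambda>u. f (w u))"
proof -
  have w: "differentiable_times_on k S w" for k
    using assms(3) by (simp add: smooth_on_def)
  have wD: "(w has_derivative frechet_derivative w (at u)) (at u)" if "u \<in> S" for u
    using w[of 1] that by (simp add: frechet_derivative_works)
  have "differentiable_times_on k S' f \<Longrightarrow> differentiable_times_on k S (\<lambda>u. f (w u))" for k
  proof (induction k arbitrary: f)
    case 0
    then show ?case
      using w[of 0] assms(4) by (auto intro: continuous_on_compose2)
  next
    case (Suc k)
    \<comment> \<open>The direction in which \<open>f\<close> is differentiated varies with
      \<open>u\<close>. Expanding it in the basis leaves derivatives of \<open>f\<close> in fixed
      directions \<open>b\<close>, composed with \<open>w\<close>, to which the induction hypothesis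
      applies.\<close>
    let ?D = "\<lambda>u v. \<Sum>b\<in>Basis. (frechet_derivative w (at u) v \<bullet> b) * frechet_derivative f (at (w u)) b"
    show ?case
    proof (rule differentiable_times_on_Suc[OF assms(1), where D="?D"])
      fix u assume u: "u \<in> S"
      have fD: "(f has_derivative frechet_derivative f (at (w u))) (at (w u))"
        using Suc.prems u assms(4) by (auto simp: frechet_derivative_works)
      interpret F: bounded_linear "frechet_derivative f (at (w u))"
        using fD by (rule has_derivative_bounded_linear)
      have "frechet_derivative f (at (w u)) (frechet_derivative w (at u) v) = ?D u v" for v
        using F.linear_axioms
        by (subst euclidean_representation[symmetric, of "frechet_derivative w (at u) v"])
          (simp add: F.sum F.scaleR)
      then show "((\<lambda>u. f (w u)) has_derivative ?D u) (at u)"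
        using has_derivative_compose[OF wD[OF u] fD] by (simp add: fun_eq_iff)
    next
      fix v
      have "differentiable_times_on k S (\<lambda>u. frechet_derivative w (at u) v)"
        using w[of "Suc k"] by simp
      then show "differentiable_times_on k S (\<lambda>u. ?D u v)"
        using Suc assms(1)
        by (intro differentiable_times_on_sum differentiable_times_on_mult
            differentiable_times_on_inner) auto
    qed
  qed
  then show ?thesis using assms(5) by (simp add: smooth_on_def)
qed

text \<open>The partial derivatives are continuous, hence bounded on a compact ball; their bounds
  add up to a bound of the operator norm, and the mean value inequality holds because the ball is
  convex.\<close>

lemma smooth_on_imp_locally_lipschitz:
  fixes g :: "'a::euclidean_space \<Rightarrow> real"
  assumes "open S" "smooth_on S g" "a \<in> S"
  obtains r L where "r > 0" "cball a r \<subseteq> S" 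
    "\<And>u v. u \<in> cball a r \<Longrightarrow> v \<in> cball a r \<Longrightarrow> \<bar>g u - g v\<bar> \<le> L * norm (u - v)"
proof -
  obtain r where r: "r > 0" "cball a r \<subseteq> S"
    using assms(1,3) open_contains_cball by blast
  have *: "differentiable_times_on (Suc 0) S g"
    using assms(2) by (simp add: smooth_on_def del: differentiable_times_on.simps)
  let ?D = "\<lambda>u. frechet_derivative g (at u)"
  have D: "(g has_derivative ?D u) (at u)" if "u \<in> S" for u
    using * that by (simp add: frechet_derivative_works)
  have "\<exists>M. \<forall>u\<in>cball a r. \<bar>?D u b\<bar> \<le> M" for b
  proof -
    have "continuous_on (cball a r) (\<lambda>u. ?D u b)"
      using * r(2) by (auto intro: continuous_on_subset)
    then have "bounded ((\<lambda>u. ?D u b) ` cball a r)"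
      by (intro compact_imp_bounded compact_continuous_image) auto
    then show ?thesis by (auto simp: bounded_iff)
  qed
  then obtain M where M: "\<And>b u. u \<in> cball a r \<Longrightarrow> \<bar>?D u b\<bar> \<le> M b" by metis
  have on: "onorm (?D u) \<le> (\<Sum>b\<in>Basis. M b)" if u: "u \<in> cball a r" for u
  proof (rule onorm_le)
    fix d
    interpret F: bounded_linear "?D u"
      using D r(2) u has_derivative_bounded_linear by blast
    have "?D u d = (\<Sum>b\<in>Basis. (d \<bullet> b) * ?D u b)"
      by (subst euclidean_representation[symmetric, of d]) (simp add: F.sum F.scaleR)
    also have "\<bar>\<dots>\<bar> \<le> (\<Sum>b\<in>Basis. norm d * M b)"
      by (rule order_trans[OF sum_abs])
        (auto intro!: sum_mono mult_mono M[OF u] simp: abs_mult Basis_le_norm)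
    finally show "norm (?D u d) \<le> (\<Sum>b\<in>Basis. M b) * norm d"
      by (simp add: sum_distrib_left mult.commute)
  qed
  have lip: "norm (g u - g v) \<le> (\<Sum>b\<in>Basis. M b) * norm (u - v)"
    if "u \<in> cball a r" "v \<in> cball a r" for u v
    by (rule differentiable_bound[OF convex_cball has_derivative_at_withinI[OF D] on that])
      (use r(2) in blast)+
  show ?thesis
    by (rule that[OF r lip[unfolded real_norm_def]])
qed

section \<open>A smooth plateau function\<close>

text \<open>The factor \<open>1 / s ^ k\<close> closes the family under differentiation.\<close>

definition flat_exp :: "nat \<Rightarrow> real \<Rightarrow> real" where
  "flat_exp k s = (if s > 0 then exp (- 1 / s) / s ^ k else 0)"

text \<open>Away from 0 this is a computation. At 0 the right difference quotient is t^(k+1) / exp t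
  with t = 1/s, which tends to 0 as t grows; on the left it is identically 0.\<close>

lemma has_real_derivative_flat_exp:
  "(flat_exp k has_real_derivative flat_exp (k + 2) s - real k * flat_exp (k + 1) s) (at s)"
proof -
  consider "s > 0" | "s < 0" | "s = 0" by linarith
  then show ?thesis
  proof cases
    case 1
    have pow: "((\<lambda>s. s ^ k) has_real_derivative real k * s ^ k / s) (at s)"
      using DERIV_pow[of k s] 1 by (cases k) auto
    have exp: "((\<lambda>s. exp (- 1 / s)) has_real_derivative exp (- 1 / s) / s ^ 2) (at s)"
      using 1 by (auto intro!: derivative_eq_intros simp: power2_eq_square)
    have eq: "(exp (- 1 / s) / s ^ 2 * s ^ k - exp (- 1 / s) * (real k * s ^ k / s)) / (s ^ k * s ^ k) =
        flat_exp (k + 2) s - real k * flat_exp (k + 1) s"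
      using 1 by (simp add: flat_exp_def field_simps power2_eq_square)
    have "((\<lambda>s. exp (- 1 / s) / s ^ k) has_real_derivative
        flat_exp (k + 2) s - real k * flat_exp (k + 1) s) (at s)"
      unfolding eq[symmetric] using 1 by (intro DERIV_divide exp pow) auto
    then show ?thesis
      by (rule has_field_derivative_transform_within_open[where S="{0<..}"])
        (use 1 in \<open>auto simp: flat_exp_def\<close>)
  next
    case 2
    have "((\<lambda>s. 0) has_real_derivative flat_exp (k + 2) s - real k * flat_exp (k + 1) s) (at s)"
      using 2 by (simp add: flat_exp_def)
    then show ?thesis
      by (rule has_field_derivative_transform_within_open[where S="{..<0}"])
        (use 2 in \<open>auto simp: flat_exp_def\<close>)
  next
    case 3
    have "((\<lambda>s. (inverse s) ^ Suc k / exp (inverse s)) \<longlongrightarrow> 0) (at_right (0::real))"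
      by (rule filterlim_compose[OF tendsto_power_div_exp_0 filterlim_inverse_at_top_right])
    then have R: "((\<lambda>s. flat_exp k s / s) \<longlongrightarrow> 0) (at_right 0)"
      by (rule Lim_transform_eventually)
        (auto simp: eventually_at_filter flat_exp_def field_simps exp_minus)
    have L: "((\<lambda>s. flat_exp k s / s) \<longlongrightarrow> 0) (at_left 0)"
      by (rule Lim_transform_eventually[OF tendsto_const])
        (auto simp: eventually_at_filter flat_exp_def)
    have "((\<lambda>s. flat_exp k s / s) \<longlongrightarrow> 0) (at 0)"
      using L R filterlim_split_at by blast
    then show ?thesis
      using 3 by (simp add: has_field_derivative_iff flat_exp_def)
  qed
qed

lemma smooth_on_flat_exp: "smooth_on UNIV (flat_exp k)"
proof -
  have "differentiable_times_on n UNIV (flat_exp k)" for n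
  proof (induction n arbitrary: k)
    case 0
    show ?case
      using DERIV_isCont[OF has_real_derivative_flat_exp]
      by (auto intro!: continuous_at_imp_continuous_on simp del: One_nat_def)
  next
    case (Suc n)
    show ?case
    proof (rule differentiable_times_on_Suc)
      show "(flat_exp k has_derivative
          (\<lambda>v. (flat_exp (k + 2) s + (- real k) * flat_exp (k + 1) s) * v)) (at s)" for s
        using has_real_derivative_flat_exp[of k s] by (simp add: has_field_derivative_def)
    qed (intro differentiable_times_on_add differentiable_times_on_mult
        differentiable_times_on_const open_UNIV Suc)+
  qed
  then show ?thesis by (simp add: smooth_on_def)
qed

text \<open>
  With \<open>E = flat_exp 0\<close>, the function \<open>s \<mapsto> 1 - E (c - E s) / E c\<close> is \<open>0\<close> for \<open>s \<le> 0\<close> and \<open>1\<close> where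
  \<open>E s \<ge> c\<close>; this form needs no smoothness of quotients.
\<close>

lemma smooth_plateau:
  fixes a :: "'a::euclidean_space"
  assumes "r > 0"
  obtains B :: "'a \<Rightarrow> real" and r' where "smooth_on UNIV B" "0 < r'" "r' \<le> r"
    "\<And>u. u \<in> ball a r' \<Longrightarrow> B u = 1" "\<And>u. u \<notin> cball a r \<Longrightarrow> B u = 0"
proof -
  let ?E = "flat_exp 0"
  \<comment> \<open>\<open>q\<close> equals 1 at the centre and is at most 0 outside the ball of
    radius \<open>r\<close>; it is at least 1/2 on the ball of radius \<open>r/2\<close>, so there
    \<open>?E (q u)\<close> reaches the threshold \<open>c\<close>. Both \<open>q\<close> and
    \<open>B\<close> are spelled with sums and products only, matching the closure rules.\<close>
  define c where "c = ?E (1/2)"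
  define q where "q u = 1 + (- 1 / r\<^sup>2) * (\<Sum>b\<in>Basis. (u \<bullet> b + - (a \<bullet> b)) * (u \<bullet> b + - (a \<bullet> b)))" for u
  define B where "B u = 1 + (- 1 / ?E c) * ?E (c + (- 1) * ?E (q u))" for u
  have c: "c > 0" by (simp add: c_def flat_exp_def)
  then have Ec: "?E c > 0" by (simp add: flat_exp_def)
  have q: "q u = 1 - (dist a u / r)\<^sup>2" for u
  proof -
    have "(dist a u)\<^sup>2 = (u - a) \<bullet> (u - a)"
      by (simp add: dist_norm norm_minus_commute[of a] power2_norm_eq_inner)
    then show ?thesis
      using euclidean_inner[of "u - a" "u - a"]
      by (simp add: q_def power_divide inner_diff_left)
  qed
  have "smooth_on UNIV q"
    unfolding q_def
    by (intro smooth_on_add smooth_on_mult smooth_on_sum smooth_on_const smooth_on_inner_left open_UNIV)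
  then have "smooth_on UNIV (\<lambda>u. ?E (q u))"
    by (rule smooth_on_compose[rotated 2, where S'=UNIV]) (auto intro: smooth_on_flat_exp)
  then have "smooth_on UNIV (\<lambda>u. c + (- 1) * ?E (q u))"
    by (intro smooth_on_add smooth_on_mult smooth_on_const open_UNIV)
  then have "smooth_on UNIV (\<lambda>u. ?E (c + (- 1) * ?E (q u)))"
    by (rule smooth_on_compose[rotated 2, where S'=UNIV]) (auto intro: smooth_on_flat_exp)
  then have "smooth_on UNIV B"
    unfolding B_def by (intro smooth_on_add smooth_on_mult smooth_on_const open_UNIV)
  moreover have "B u = 1" if "u \<in> ball a (r/2)" for u
  proof -
    have "dist a u / r \<le> 1/2" using that assms by (simp add: field_simps)
    then have "(dist a u / r)\<^sup>2 \<le> (1/2)\<^sup>2" using assms by (intro power_mono) auto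
    then have "(dist a u / r)\<^sup>2 \<le> 1/2" by (rule order_trans) (simp add: power2_eq_square)
    then have "q u \<ge> 1/2" unfolding q by linarith
    then have "?E (q u) \<ge> c" by (simp add: c_def flat_exp_def field_simps)
    then show ?thesis by (simp add: B_def flat_exp_def)
  qed
  moreover have "B u = 0" if "u \<notin> cball a r" for u
  proof -
    have "dist a u / r \<ge> 1" using that assms by simp
    then have "(dist a u / r)\<^sup>2 \<ge> 1" by simp
    then have "?E (q u) = 0" by (simp add: q flat_exp_def)
    then show ?thesis using Ec by (simp add: B_def)
  qed
  ultimately show ?thesis using assms by (intro that[of B "r/2"]) auto
qed

section \<open>Gronwall's inequality\<close>

text \<open>Integrating factors: forward of \<open>t0\<close> the function
  \<open>E t * exp (- K * t)\<close> does not increase, and backward of \<open>t0\<close> the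
  function \<open>E t * exp (K * t)\<close> cannot exceed its value at \<open>t0\<close>. Together
  with \<open>E \<ge> 0\<close> this forces 0 on both sides.\<close>

lemma gronwall_zero:
  fixes E :: "real \<Rightarrow> real"
  assumes J: "is_interval J" "t0 \<in> J" "t \<in> J"
    and E: "E t0 = 0" "\<And>t. t \<in> J \<Longrightarrow> E t \<ge> 0"
    and deriv: "\<And>t. t \<in> J \<Longrightarrow> (E has_real_derivative E' t) (at t)"
    and bound: "\<And>t. t \<in> J \<Longrightarrow> \<bar>E' t\<bar> \<le> K * E t"
  shows "E t = 0"
proof (cases "t0 \<le> t")
  case True
  have "E t * exp (- K * t) \<le> E t0 * exp (- K * t0)"
  proof (rule DERIV_nonpos_imp_nonincreasing[OF True])
    fix s assume "t0 \<le> s" "s \<le> t"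
    then have s: "s \<in> J" using J mem_is_interval_1_I by blast
    have "((\<lambda>s. E s * exp (- K * s)) has_real_derivative (E' s - K * E s) * exp (- K * s)) (at s)"
      by (auto intro!: derivative_eq_intros deriv[OF s] simp: algebra_simps)
    moreover have "(E' s - K * E s) * exp (- K * s) \<le> 0"
      using bound[OF s] by (intro mult_nonpos_nonneg) auto
    ultimately show "\<exists>d. ((\<lambda>s. E s * exp (- K * s)) has_real_derivative d) (at s) \<and> d \<le> 0"
      by blast
  qed
  then show ?thesis using E J by (auto simp: mult_le_0_iff intro: antisym)
next
  case False
  then have "t \<le> t0" by simp
  have "E t * exp (K * t) \<le> E t0 * exp (K * t0)"
  proof (rule DERIV_nonneg_imp_nondecreasing[OF \<open>t \<le> t0\<close>])
    fix s assume "t \<le> s" "s \<le> t0"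
    then have s: "s \<in> J" using J mem_is_interval_1_I by blast
    have "((\<lambda>s. E s * exp (K * s)) has_real_derivative (E' s + K * E s) * exp (K * s)) (at s)"
      by (auto intro!: derivative_eq_intros deriv[OF s] simp: algebra_simps)
    moreover have "(E' s + K * E s) * exp (K * s) \<ge> 0"
      using bound[OF s] by (intro mult_nonneg_nonneg) auto
    ultimately show "\<exists>d. ((\<lambda>s. E s * exp (K * s)) has_real_derivative d) (at s) \<and> d \<ge> 0"
      by blast
  qed
  then show ?thesis using E J by (auto simp: mult_le_0_iff intro: antisym)
qed

text \<open>The scalar case is applied to the sum of squares, which unlike the sum of absolute
  values is differentiable. Cauchy-Schwarz compares the two at the price of a factor
  \<open>card A\<close>; \<open>\<bar>L\<bar>\<close> appears because \<open>L\<close> has no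
  assumed sign.\<close>

lemma gronwall_zero_system:
  fixes u u' :: "'i \<Rightarrow> real \<Rightarrow> real"
  assumes A: "finite A" and J: "is_interval J" "t0 \<in> J"
    and init: "\<And>i. i \<in> A \<Longrightarrow> u i t0 = 0"
    and deriv: "\<And>i t. i \<in> A \<Longrightarrow> t \<in> J \<Longrightarrow> (u i has_real_derivative u' i t) (at t)"
    and bound: "\<And>i t. i \<in> A \<Longrightarrow> t \<in> J \<Longrightarrow> \<bar>u' i t\<bar> \<le> L * (\<Sum>k\<in>A. \<bar>u k t\<bar>)"
    and "i \<in> A" "t \<in> J"
  shows "u i t = 0"
proof -
  let ?E = "\<lambda>t. \<Sum>i\<in>A. (u i t)\<^sup>2" and ?E' = "\<lambda>t. \<Sum>i\<in>A. 2 * u i t * u' i t"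
  have "?E t = 0"
  proof (rule gronwall_zero[OF J \<open>t \<in> J\<close>, where E="?E" and E'="?E'" and K="2 * \<bar>L\<bar> * card A"])
    fix t assume t: "t \<in> J"
    show "(?E has_real_derivative ?E' t) (at t)"
      by (auto intro!: derivative_eq_intros deriv t simp: mult_ac)
    have "\<bar>?E' t\<bar> \<le> (\<Sum>i\<in>A. 2 * \<bar>u i t\<bar> * (\<bar>L\<bar> * (\<Sum>k\<in>A. \<bar>u k t\<bar>)))"
    proof (rule order_trans[OF sum_abs sum_mono])
      fix i assume i: "i \<in> A"
      have "\<bar>u' i t\<bar> \<le> \<bar>L\<bar> * (\<Sum>k\<in>A. \<bar>u k t\<bar>)"
        using bound[OF i t] by (rule order_trans) (auto intro: mult_right_mono sum_nonneg)
      then show "\<bar>2 * u i t * u' i t\<bar> \<le> 2 * \<bar>u i t\<bar> * (\<bar>L\<bar> * (\<Sum>k\<in>A. \<bar>u k t\<bar>))"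
        by (simp add: abs_mult mult_left_mono)
    qed
    also have "\<dots> = 2 * \<bar>L\<bar> * (\<Sum>k\<in>A. \<bar>u k t\<bar>)\<^sup>2"
      by (simp add: power2_eq_square sum_distrib_left sum_distrib_right mult_ac)
    also have "\<dots> \<le> 2 * \<bar>L\<bar> * ((\<Sum>k\<in>A. \<bar>u k t\<bar>\<^sup>2) * card A)"
      by (intro mult_left_mono sum_squared_le_sum_of_squares A) auto
    finally show "\<bar>?E' t\<bar> \<le> 2 * \<bar>L\<bar> * card A * ?E t" by (simp add: mult_ac)
  qed (auto intro: sum_nonneg simp: init)
  then show ?thesis using A \<open>i \<in> A\<close> by (simp add: sum_nonneg_eq_0_iff)
qed

section \<open>Bump functions and locality of the Poisson bracket\<close>

text \<open>The Hausdorff sort enters twice: compact supports inside a chart are closed in the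
  manifold, and the set where two curves differ is open.\<close>

locale poisson_manifold =
  fixes atl :: "('m::t2_space, 'e::euclidean_space) chart set" and pb :: "'m bracket"
  assumes atlas: "smooth_atlas atl" and poisson: "poisson_bracket atl pb"
begin

lemma chartD:
  assumes "(U, \<phi>) \<in> atl"
  shows "open U" "open (\<phi> ` U)" "continuous_on U \<phi>" "continuous_on (\<phi> ` U) (inv_into U \<phi>)"
    "inj_on \<phi> U"
  using assms atlas
  by (auto simp: smooth_atlas_def is_chart_def homeomorphism_def
      intro!: inj_on_inverseI[where g="inv_into U \<phi>"] dest!: bspec)

lemma open_chart_image:
  assumes c: "(U, \<phi>) \<in> atl" and "open W"
  shows "open (\<phi> ` (U \<inter> W))"
proof -
  have "\<phi> ` (U \<inter> W) = \<phi> ` U \<inter> inv_into U \<phi> -` W"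
    using inv_into_f_f[OF chartD(5)[OF c]] by (force simp: image_iff)
  then show ?thesis
    using continuous_open_preimage[OF chartD(4,2)[OF c] \<open>open W\<close>] by simp
qed

lemma smooth_fun_const: "smooth_fun atl (\<lambda>z. a)"
  unfolding smooth_fun_def o_def by (auto intro: smooth_on_const chartD)

lemma smooth_fun_add: "smooth_fun atl f \<Longrightarrow> smooth_fun atl g \<Longrightarrow> smooth_fun atl (\<lambda>z. f z + g z)"
  unfolding smooth_fun_def o_def by (fast intro: smooth_on_add chartD)

lemma smooth_fun_mult: "smooth_fun atl f \<Longrightarrow> smooth_fun atl g \<Longrightarrow> smooth_fun atl (\<lambda>z. f z * g z)"
  unfolding smooth_fun_def o_def by (fast intro: smooth_on_mult chartD)

lemma smooth_fun_sum:
  "(\<And>i. i \<in> A \<Longrightarrow> smooth_fun atl (f i)) \<Longrightarrow> smooth_fun atl (\<lambda>z. \<Sum>i\<in>A. f i z)"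
  by (induction A rule: infinite_finite_induct) (auto intro: smooth_fun_add smooth_fun_const)

lemma smooth_fun_prod:
  "(\<And>i. i \<in> A \<Longrightarrow> smooth_fun atl (f i)) \<Longrightarrow> smooth_fun atl (\<lambda>z. \<Prod>i\<in>A. f i z)"
  by (induction A rule: infinite_finite_induct) (auto intro: smooth_fun_mult smooth_fun_const)

lemma smooth_fun_pb: "smooth_fun atl f \<Longrightarrow> smooth_fun atl g \<Longrightarrow> smooth_fun atl (pb f g)"
  using poisson by (simp add: poisson_bracket_def)

text \<open>Extension by zero. Any other chart domain \<open>V\<close> is the union of two open
  pieces: \<open>V \<inter> U\<close>, where the transition map carries the smoothness over, and
  \<open>V \<inter> - K\<close>, where \<open>g\<close> vanishes.\<close>

lemma smooth_fun_if_closed_support: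
  assumes c: "(U, \<phi>) \<in> atl" and K: "closed K" "K \<subseteq> U"
    and g: "smooth_on (\<phi> ` U) (g \<circ> inv_into U \<phi>)" and supp: "\<And>z. z \<notin> K \<Longrightarrow> g z = 0"
  shows "smooth_fun atl g"
proof -
  have "smooth_on (\<psi> ` V) (g \<circ> inv_into V \<psi>)" if d: "(V, \<psi>) \<in> atl" for V \<psi>
  proof -
    note inv = inv_into_f_f[OF chartD(5)[OF d]] inv_into_f_f[OF chartD(5)[OF c]]
    have o: "open (\<psi> ` (V \<inter> U))" "open (\<psi> ` (V \<inter> - K))"
      using open_chart_image[OF d] chartD(1)[OF c] K by auto
    have "smooth_transition (V, \<psi>) (U, \<phi>)"
      using atlas c d by (simp add: smooth_atlas_def)
    then have "smooth_on (\<psi> ` (V \<inter> U)) (\<phi> \<circ> inv_into V \<psi>)"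
      by (simp add: smooth_transition_def)
    then have "smooth_on (\<psi> ` (V \<inter> U)) (\<lambda>v. (g \<circ> inv_into U \<phi>) ((\<phi> \<circ> inv_into V \<psi>) v))"
      by (rule smooth_on_compose[OF o(1) chartD(2)[OF c] _ _ g]) (auto simp: inv)
    then have 1: "smooth_on (\<psi> ` (V \<inter> U)) (g \<circ> inv_into V \<psi>)"
      by (rule smooth_on_cong[OF _ o(1)]) (auto simp: inv)
    have 2: "smooth_on (\<psi> ` (V \<inter> - K)) (g \<circ> inv_into V \<psi>)"
      by (rule smooth_on_cong[OF smooth_on_const[OF o(2), of 0] o(2)]) (auto simp: inv supp)
    have "\<psi> ` V = \<psi> ` (V \<inter> U) \<union> \<psi> ` (V \<inter> - K)" using K by blast
    then show ?thesis using smooth_on_Un[OF o 1 2] by simp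
  qed
  then show ?thesis by (auto simp: smooth_fun_def)
qed

text \<open>A plateau function in coordinates, extended by zero; its support lies in the compact set
  \<open>K\<close>. The products with the coordinates are globally smooth functions that agree with
  the coordinates on \<open>V\<close>, so curves can be tested against them.\<close>

lemma smooth_bump:
  assumes c: "(U, \<phi>) \<in> atl" and "y \<in> U" "open N" "y \<in> N"
  obtains b V where "open V" "y \<in> V" "V \<subseteq> U \<inter> N" "\<And>z. z \<in> V \<Longrightarrow> b z = 1" "\<And>z. z \<notin> N \<Longrightarrow> b z = 0"
    "smooth_fun atl b" "\<And>e. smooth_fun atl (\<lambda>z. b z * (\<phi> z \<bullet> e))"
proof -
  note inv = inv_into_f_f[OF chartD(5)[OF c]]
  have "\<phi> y \<in> \<phi> ` (U \<inter> N)" using assms by blast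
  then obtain r where r: "r > 0" "cball (\<phi> y) r \<subseteq> \<phi> ` (U \<inter> N)"
    using open_chart_image[OF c \<open>open N\<close>] open_contains_cball by metis
  obtain B r' where B: "smooth_on UNIV B" "0 < r'" "r' \<le> r"
    "\<And>u. u \<in> ball (\<phi> y) r' \<Longrightarrow> B u = (1::real)" "\<And>u. u \<notin> cball (\<phi> y) r \<Longrightarrow> B u = 0"
    using smooth_plateau[OF r(1), of "\<phi> y"] by blast
  define b where "b z = (if z \<in> U then B (\<phi> z) else 0)" for z
  define K where "K = inv_into U \<phi> ` cball (\<phi> y) r"
  define V where "V = U \<inter> \<phi> -` ball (\<phi> y) r'"
  have "compact K"
    unfolding K_def using r(2)
    by (intro compact_continuous_image continuous_on_subset[OF chartD(4)[OF c]]) auto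
  then have "closed K" by (rule compact_imp_closed)
  moreover have "z \<in> U \<inter> N" if z: "z \<in> K" for z
  proof -
    obtain u where u: "u \<in> cball (\<phi> y) r" "z = inv_into U \<phi> u"
      using z unfolding K_def by blast
    then obtain w where "w \<in> U \<inter> N" "u = \<phi> w" using r(2) by blast
    then show ?thesis using u inv by simp
  qed
  ultimately have K: "closed K" "K \<subseteq> U" "K \<subseteq> N" by blast+
  have supp: "b z = 0" if "z \<notin> K" for z
  proof (cases "z \<in> U")
    case True
    then have "\<phi> z \<notin> cball (\<phi> y) r" using that inv[OF True] unfolding K_def by (metis imageI)
    then show ?thesis using B(5) by (simp add: b_def)
  qed (simp add: b_def)
  have "V \<subseteq> K"
  proof
    fix z assume z: "z \<in> V"
    then have "\<phi> z \<in> cball (\<phi> y) r" using B(3) by (simp add: V_def)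
    then have "inv_into U \<phi> (\<phi> z) \<in> K" unfolding K_def by (rule imageI)
    then show "z \<in> K" using z by (simp add: V_def inv)
  qed
  have sm: "smooth_on (\<phi> ` U) (b \<circ> inv_into U \<phi>)"
    by (rule smooth_on_cong[OF smooth_on_subset[OF B(1)] chartD(2)[OF c]]) (auto simp: b_def inv)
  have "smooth_on (\<phi> ` U) (\<lambda>u. (b \<circ> inv_into U \<phi>) u * (u \<bullet> e))" for e
    by (intro smooth_on_mult smooth_on_inner_left chartD(2)[OF c] sm)
  then have sm': "smooth_on (\<phi> ` U) ((\<lambda>z. b z * (\<phi> z \<bullet> e)) \<circ> inv_into U \<phi>)" for e
    by (rule smooth_on_cong[OF _ chartD(2)[OF c]]) (auto simp: inv)
  show ?thesis
  proof (rule that[of V b])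
    show "open V"
      unfolding V_def by (rule continuous_open_preimage[OF chartD(3,1)[OF c] open_ball])
    show "y \<in> V" using assms B by (simp add: V_def)
    show "V \<subseteq> U \<inter> N" using \<open>V \<subseteq> K\<close> K by blast
    show "b z = 1" if "z \<in> V" for z using that B(4) by (simp add: V_def b_def)
    show "b z = 0" if "z \<notin> N" for z using that K supp by blast
    show "smooth_fun atl b"
      by (rule smooth_fun_if_closed_support[OF c K(1,2) sm supp])
    show "smooth_fun atl (\<lambda>z. b z * (\<phi> z \<bullet> e))" for e
      by (rule smooth_fun_if_closed_support[OF c K(1,2) sm']) (simp add: supp)
  qed
qed

lemma chart_at: obtains U \<phi> where "(U, \<phi>) \<in> atl" "y \<in> U"
proof -
  have "y \<in> (\<Union>c\<in>atl. fst c)" using atlas by (simp add: smooth_atlas_def)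
  then show ?thesis using that by (metis UN_E prod.collapse)
qed

section \<open>Algebra and locality of the bracket\<close>

lemma pb_antisym: "smooth_fun atl f \<Longrightarrow> smooth_fun atl g \<Longrightarrow> pb f g y = - pb g f y"
  using poisson[unfolded poisson_bracket_def, THEN conjunct1, THEN spec, THEN spec, THEN mp, of f g]
  by simp

lemma
  assumes "smooth_fun atl f" "smooth_fun atl g" "smooth_fun atl h"
  shows pb_comb_left: "pb (\<lambda>z. a * f z + b * g z) h y = a * pb f h y + b * pb g h y"
    and pb_mult_right: "pb f (\<lambda>z. g z * h z) y = pb f g y * h y + g y * pb f h y"
  using poisson[unfolded poisson_bracket_def, THEN conjunct2, THEN spec, THEN spec, THEN spec,
      THEN mp, of f g h] assms
  by simp_all

lemma pb_mult_left:
  "smooth_fun atl f \<Longrightarrow> smooth_fun atl g \<Longrightarrow> smooth_fun atl h \<Longrightarrow>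
    pb (\<lambda>z. f z * g z) h y = pb f h y * g y + f y * pb g h y"
  using pb_mult_right[of h f g y] pb_antisym[of "\<lambda>z. f z * g z" h y] pb_antisym[of h f y]
    pb_antisym[of h g y] by (simp add: smooth_fun_mult)

text \<open>Follows from the Leibniz rule applied to 0 = 0 * 0.\<close>

lemma pb_zero_right: "smooth_fun atl f \<Longrightarrow> pb f (\<lambda>z. 0) y = 0"
  using pb_mult_right[of f "\<lambda>z. 0" "\<lambda>z. 0" y] by (simp add: smooth_fun_const)

lemma pb_uminus_left:
  "smooth_fun atl f \<Longrightarrow> smooth_fun atl h \<Longrightarrow> pb (\<lambda>z. - f z) h y = - pb f h y"
  using pb_comb_left[of f f h "-1" 0 y] by simp

lemma pb_sum_left:
  assumes "finite A" "\<And>i. i \<in> A \<Longrightarrow> smooth_fun atl (f i)" "smooth_fun atl h"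
  shows "pb (\<lambda>z. \<Sum>i\<in>A. f i z) h y = (\<Sum>i\<in>A. pb (f i) h y)"
  using assms(1,2)
proof (induction A)
  case empty
  then show ?case
    using pb_zero_right[of h y] pb_antisym[of "\<lambda>z. 0" h y] assms(3) by (simp add: smooth_fun_const)
next
  case (insert i A)
  then show ?case
    using pb_comb_left[of "f i" "\<lambda>z. \<Sum>i\<in>A. f i z" h 1 1 y] assms(3) by (simp add: smooth_fun_sum)
qed

text \<open>Locality: the difference \<open>?d\<close> times a bump function supported in
  \<open>N\<close> is identically zero. At \<open>y\<close> the bump is 1 and \<open>?d\<close> is
  0, so the Leibniz rule leaves only the bracket with \<open>?d\<close>.\<close>

lemma pb_cong_left:
  assumes "smooth_fun atl h" "smooth_fun atl h'" "smooth_fun atl f"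
    and "\<forall>\<^sub>F z in nhds y. h z = h' z"
  shows "pb h f y = pb h' f y"
proof -
  obtain N where N: "open N" "y \<in> N" "\<And>z. z \<in> N \<Longrightarrow> h z = h' z"
    using assms(4) by (auto simp: eventually_nhds)
  obtain U \<phi> where c: "(U, \<phi>) \<in> atl" "y \<in> U" by (rule chart_at)
  obtain b V where b: "y \<in> V" "\<And>z. z \<in> V \<Longrightarrow> b z = 1" "\<And>z. z \<notin> N \<Longrightarrow> b z = 0" "smooth_fun atl b"
    by (rule smooth_bump[OF c N(1,2)]) blast
  let ?d = "\<lambda>z. 1 * h z + (- 1) * h' z"
  have d: "smooth_fun atl ?d"
    by (intro smooth_fun_add smooth_fun_mult smooth_fun_const assms)
  have "(\<lambda>z. ?d z * b z) = (\<lambda>z. 0)" using N(3) b(3) by fastforce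
  then have "pb f ?d y = 0"
    using pb_mult_right[OF assms(3) d b(4), of y] b(2)[OF b(1)] N pb_zero_right[OF assms(3), of y]
    by simp
  then have "pb ?d f y = 0"
    using pb_antisym[OF d assms(3), of y] by simp
  then show ?thesis
    using pb_comb_left[OF assms(1-3), of 1 "-1" y] by simp
qed

section \<open>Uniqueness of integral curves\<close>

text \<open>The definition of an integral curve lets the smooth representative of \<open>H\<close>
  depend on the time; by locality of the bracket any representative may be used instead.\<close>

lemma integral_curve_deriv:
  assumes "integral_curve atl pb H I c" "t \<in> I" "smooth_fun atl h" "smooth_fun atl f"
    and "\<forall>\<^sub>F z in nhds (c t). h z = H z"
  shows "((\<lambda>s. f (c s)) has_real_derivative pb h f (c t)) (at t)"
proof -
  obtain h' where h': "smooth_fun atl h'" "\<forall>\<^sub>F z in nhds (c t). h' z = H z"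
    "((\<lambda>s. f (c s)) has_real_derivative pb h' f (c t)) (at t)"
    using assms(1,2,4) unfolding integral_curve_def by blast
  have "\<forall>\<^sub>F z in nhds (c t). h' z = h z"
    using h'(2) assms(5) by eventually_elim simp
  then show ?thesis
    using h' pb_cong_left[OF h'(1) assms(3,4)] by simp
qed

text \<open>In a chart around the common point both curves solve the same differential equation with
  a locally Lipschitz right-hand side, so the coordinate differences satisfy the hypotheses of
  Gronwall's inequality.\<close>

lemma integral_curves_locally_equal:
  assumes I: "open I" "t0 \<in> I"
    and c1: "integral_curve atl pb H I c1" and c2: "integral_curve atl pb H I c2"
    and eq: "c1 t0 = c2 t0"
  obtains \<delta> where "\<delta> > 0" "\<And>t. t \<in> ball t0 \<delta> \<Longrightarrow> t \<in> I \<and> c1 t = c2 t"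
proof -
  define y where "y = c1 t0"
  have cont: "continuous_on I c1" "continuous_on I c2"
    using c1 c2 by (simp_all add: integral_curve_def)
  \<comment> \<open>A single representative \<open>h\<close> of \<open>H\<close> near
    \<open>y\<close>, used for both curves at all times close to \<open>t0\<close>.\<close>
  obtain h where h: "smooth_fun atl h" "\<forall>\<^sub>F z in nhds y. h z = H z"
    using c1 I(2) unfolding integral_curve_def y_def by blast
  then obtain N where N: "open N" "y \<in> N" "\<And>z. z \<in> N \<Longrightarrow> h z = H z"
    by (auto simp: eventually_nhds)
  obtain U \<phi> where c: "(U, \<phi>) \<in> atl" "y \<in> U" by (rule chart_at)
  note inv = inv_into_f_f[OF chartD(5)[OF c(1)]]
  obtain b V where V: "open V" "y \<in> V" "V \<subseteq> U \<inter> N" and b: "\<And>z. z \<in> V \<Longrightarrow> b z = 1"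
    and X: "\<And>e. smooth_fun atl (\<lambda>z. b z * (\<phi> z \<bullet> e))"
    by (rule smooth_bump[OF c N(1,2)]) blast
  define X where "X e z = b z * (\<phi> z \<bullet> e)" for e z
  have smX: "smooth_fun atl (X e)" for e
    using X[of e] by (simp add: X_def[abs_def])
  \<comment> \<open>Near \<open>\<phi> y\<close>, \<open>g e\<close> is the
    \<open>e\<close>-component of the Hamiltonian vector field in coordinates, since
    \<open>X e\<close> is the coordinate itself on \<open>V\<close>.\<close>
  define g where "g e = pb h (X e) \<circ> inv_into U \<phi>" for e
  have smg: "smooth_on (\<phi> ` U) (g e)" for e
    using smooth_fun_pb[OF h(1) smX] c(1) by (auto simp: smooth_fun_def g_def)
  have "\<exists>r L. r > 0 \<and> (\<forall>u\<in>cball (\<phi> y) r. \<forall>v\<in>cball (\<phi> y) r. \<bar>g e u - g e v\<bar> \<le> L * norm (u - v))" for e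
    using smooth_on_imp_locally_lipschitz[OF chartD(2)[OF c(1)] smg[of e], of "\<phi> y"] c(2)
    by (metis imageI)
  then obtain r L where r: "\<And>e. r e > 0" and L: "\<And>e u v. u \<in> cball (\<phi> y) (r e) \<Longrightarrow>
      v \<in> cball (\<phi> y) (r e) \<Longrightarrow> \<bar>g e u - g e v\<bar> \<le> L e * norm (u - v)"
    by metis
  define r0 where "r0 = Min (r ` Basis)"
  have r0: "r0 > 0" "\<And>e. e \<in> Basis \<Longrightarrow> r0 \<le> r e" using r by (auto simp: r0_def)
  \<comment> \<open>On \<open>W\<close> all local data are valid at once: the bump is 1,
    \<open>h\<close> agrees with \<open>H\<close>, and all components \<open>g e\<close> with
    \<open>e\<close> in the basis are Lipschitz.\<close>
  define W where "W = V \<inter> (U \<inter> \<phi> -` ball (\<phi> y) r0)"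
  have "open W"
    unfolding W_def
    by (intro open_Int V continuous_open_preimage[OF chartD(3,1)[OF c(1)]] open_ball)
  then have "open ((I \<inter> c1 -` W) \<inter> (I \<inter> c2 -` W))"
    by (intro open_Int continuous_open_preimage cont I)
  moreover have "t0 \<in> (I \<inter> c1 -` W) \<inter> (I \<inter> c2 -` W)"
    using I eq V c r0 by (simp add: W_def y_def)
  ultimately obtain \<delta> where \<delta>: "\<delta> > 0" "ball t0 \<delta> \<subseteq> (I \<inter> c1 -` W) \<inter> (I \<inter> c2 -` W)"
    using open_contains_ball by blast
  have deriv: "((\<lambda>s. \<phi> (c s) \<bullet> e) has_real_derivative g e (\<phi> (c t))) (at t)"
    if c: "integral_curve atl pb H I c" "ball t0 \<delta> \<subseteq> I \<inter> c -` W" and t: "t \<in> ball t0 \<delta>" for c t e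
  proof -
    have ct: "c s \<in> V" "c s \<in> U" "c s \<in> N" "s \<in> I" if "s \<in> ball t0 \<delta>" for s
      using c(2) that V(3) by (auto simp: W_def)
    have "((\<lambda>s. X e (c s)) has_real_derivative pb h (X e) (c t)) (at t)"
    proof (rule integral_curve_deriv[OF c(1) ct(4)[OF t] h(1) smX])
      show "\<forall>\<^sub>F z in nhds (c t). h z = H z"
        using N ct(3)[OF t] eventually_nhds by blast
    qed
    then have "((\<lambda>s. \<phi> (c s) \<bullet> e) has_real_derivative pb h (X e) (c t)) (at t)"
      by (rule has_field_derivative_transform_within_open[where S="ball t0 \<delta>"])
        (use t ct(1) b in \<open>auto simp: X_def\<close>)
    then show ?thesis by (simp add: g_def inv ct(2)[OF t])
  qed
  have d1: "ball t0 \<delta> \<subseteq> I \<inter> c1 -` W" and d2: "ball t0 \<delta> \<subseteq> I \<inter> c2 -` W" using \<delta>(2) by auto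
  have in_ball: "\<phi> (c1 t) \<in> ball (\<phi> y) r0" "\<phi> (c2 t) \<in> ball (\<phi> y) r0" "c1 t \<in> U" "c2 t \<in> U"
    if "t \<in> ball t0 \<delta>" for t
    using that d1 d2 by (auto simp: W_def)
  let ?u = "\<lambda>e t. \<phi> (c1 t) \<bullet> e - \<phi> (c2 t) \<bullet> e"
  have "c1 t = c2 t" if t: "t \<in> ball t0 \<delta>" for t
  proof -
    \<comment> \<open>The Lipschitz bounds are in the Euclidean norm; bounding it by the sum of the
      absolute coordinates gives the shape required by \<open>gronwall_zero_system\<close>.\<close>
    have zero: "?u e t = 0" if e: "e \<in> Basis" for e
    proof (rule gronwall_zero_system[where A="Basis :: 'e set" and J="ball t0 \<delta>" and ?t0.0=t0 and u="?u" and
          u'="\<lambda>e t. g e (\<phi> (c1 t)) - g e (\<phi> (c2 t))" and L="\<Sum>e\<in>Basis. \<bar>L e\<bar>"])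
      show "is_interval (ball t0 \<delta>)" by (simp add: is_interval_convex_1)
      fix e :: 'e and t assume e: "e \<in> Basis" and t: "t \<in> ball t0 \<delta>"
      show "(?u e has_real_derivative g e (\<phi> (c1 t)) - g e (\<phi> (c2 t))) (at t)"
        by (intro DERIV_diff deriv c1 c2 d1 d2 t)
      have "\<bar>g e (\<phi> (c1 t)) - g e (\<phi> (c2 t))\<bar> \<le> L e * norm (\<phi> (c1 t) - \<phi> (c2 t))"
        by (rule L) (use in_ball[OF t] r0(2)[OF e] in auto)
      also have "\<dots> \<le> (\<Sum>e\<in>Basis. \<bar>L e\<bar>) * norm (\<phi> (c1 t) - \<phi> (c2 t))"
        using member_le_sum[of e Basis "\<lambda>e. \<bar>L e\<bar>"] e by (intro mult_right_mono) auto
      also have "\<dots> \<le> (\<Sum>e\<in>Basis. \<bar>L e\<bar>) * (\<Sum>k\<in>Basis. \<bar>?u k t\<bar>)"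
        using norm_le_l1[of "\<phi> (c1 t) - \<phi> (c2 t)"]
        by (intro mult_left_mono) (auto simp: inner_diff_left intro: sum_nonneg)
      finally show "\<bar>g e (\<phi> (c1 t)) - g e (\<phi> (c2 t))\<bar> \<le> (\<Sum>e\<in>Basis. \<bar>L e\<bar>) * (\<Sum>k\<in>Basis. \<bar>?u k t\<bar>)" .
    qed (use \<delta>(1) eq t e in auto)
    have "\<phi> (c1 t) = \<phi> (c2 t)"
      by (rule euclidean_eqI) (rule right_minus_eq[THEN iffD1, OF zero])
    then show ?thesis
      using chartD(5)[OF c(1)] in_ball[OF t] by (auto dest: inj_onD)
  qed
  with \<delta> d1 show ?thesis by (intro that[of \<delta>]) auto
qed

text \<open>Connectedness: the set of agreement is open by local uniqueness, the set of disagreement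
  is open by the Hausdorff property, and the interval cannot be split.\<close>

lemma integral_curve_unique:
  assumes I: "open I" "is_interval I" "s \<in> I" "t \<in> I"
    and c1: "integral_curve atl pb H I c1" and c2: "integral_curve atl pb H I c2"
    and eq: "c1 s = c2 s"
  shows "c1 t = c2 t"
proof (rule ccontr)
  assume neq: "c1 t \<noteq> c2 t"
  let ?A = "{s \<in> I. c1 s = c2 s}" and ?B = "{s \<in> I. c1 s \<noteq> c2 s}"
  have cont: "continuous_on I c1" "continuous_on I c2"
    using c1 c2 by (simp_all add: integral_curve_def)
  have "open ?A"
    unfolding open_contains_ball
  proof
    fix s assume s: "s \<in> ?A"
    then obtain \<delta> where "\<delta> > 0" "\<And>t. t \<in> ball s \<delta> \<Longrightarrow> t \<in> I \<and> c1 t = c2 t"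
      using integral_curves_locally_equal[OF I(1) _ c1 c2] by blast
    then show "\<exists>e>0. ball s e \<subseteq> ?A" by blast
  qed
  moreover have "open ?B"
  proof (subst open_subopen, intro ballI)
    fix s assume s: "s \<in> ?B"
    then obtain P Q where PQ: "open P" "open Q" "c1 s \<in> P" "c2 s \<in> Q" "P \<inter> Q = {}"
      using hausdorff[of "c1 s" "c2 s"] by blast
    have "open ((I \<inter> c1 -` P) \<inter> (I \<inter> c2 -` Q))"
      by (intro open_Int continuous_open_preimage cont I PQ)
    moreover have "(I \<inter> c1 -` P) \<inter> (I \<inter> c2 -` Q) \<subseteq> ?B" using PQ(5) by force
    ultimately show "\<exists>T. open T \<and> s \<in> T \<and> T \<subseteq> ?B" using s PQ by blast
  qed
  moreover have "connected I" using I(2) is_interval_connected by blast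
  moreover have "?A \<inter> ?B \<inter> I = {}" "I \<subseteq> ?A \<union> ?B" by auto
  ultimately have "?A \<inter> I = {} \<or> ?B \<inter> I = {}" by (intro connectedD)
  then show False using eq neq I by blast
qed

section \<open>Flows as maps: uniqueness of end points and time reversal\<close>

lemma integral_curve_subset:
  "integral_curve atl pb H I c \<Longrightarrow> J \<subseteq> I \<Longrightarrow> integral_curve atl pb H J c"
  unfolding integral_curve_def by (blast intro: continuous_on_subset)

lemma flows_to_unique:
  assumes "flows_to atl pb H t y z" "flows_to atl pb H t y z'"
  shows "z = z'"
proof -
  obtain I c where 1: "open I" "is_interval I" "0 \<in> I" "t \<in> I" "integral_curve atl pb H I c" "c 0 = y" "c t = z"
    using assms(1) by (auto simp: flows_to_def)
  obtain I' c' where 2: "open I'" "is_interval I'" "0 \<in> I'" "t \<in> I'" "integral_curve atl pb H I' c'" "c' 0 = y" "c' t = z'"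
    using assms(2) by (auto simp: flows_to_def)
  have "c t = c' t"
    by (rule integral_curve_unique[of "I \<inter> I'" 0])
      (use 1 2 in \<open>auto intro: integral_curve_subset is_interval_Int\<close>)
  then show ?thesis using 1 2 by simp
qed

lemma ham_flow_eq: "flows_to atl pb H t y z \<Longrightarrow> ham_flow atl pb H t y = z"
  unfolding ham_flow_def using flows_to_unique by blast

text \<open>The curve run backwards from its end, \<open>\<lambda>s. c (t - s)\<close>, has opposite
  velocity and is therefore an integral curve of the negated generator.\<close>

lemma flows_to_reverse:
  assumes "flows_to atl pb H t y z"
  shows "flows_to atl pb (\<lambda>w. - H w) t z y"
proof -
  obtain I c where 1: "open I" "is_interval I" "0 \<in> I" "t \<in> I" "integral_curve atl pb H I c" "c 0 = y" "c t = z"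
    using assms by (auto simp: flows_to_def)
  let ?I = "(\<lambda>s. t - s) -` I" and ?c = "\<lambda>s. c (t - s)"
  have "open ?I" by (intro open_vimage 1 continuous_intros)
  moreover have "is_interval ?I"
    unfolding is_interval_1
  proof (intro ballI allI impI)
    fix a b s assume "a \<in> ?I" "b \<in> ?I" "a \<le> s \<and> s \<le> b"
    then show "s \<in> ?I"
      using mem_is_interval_1_I[OF 1(2), of "t - b" "t - a" "t - s"] by auto
  qed
  moreover have "integral_curve atl pb (\<lambda>w. - H w) ?I ?c"
    unfolding integral_curve_def
  proof (intro conjI ballI)
    show "continuous_on ?I ?c"
      using 1(5) unfolding integral_curve_def
      by (auto intro!: continuous_on_compose2[of I c] continuous_intros)
    fix s assume s: "s \<in> ?I"
    then obtain h where h: "smooth_fun atl h" "\<forall>\<^sub>F w in nhds (?c s). h w = H w"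
      "\<And>f. smooth_fun atl f \<Longrightarrow> ((\<lambda>s. f (c s)) has_real_derivative pb h f (?c s)) (at (t - s))"
      using 1(5) unfolding integral_curve_def by auto
    have "smooth_fun atl (\<lambda>w. - h w)"
      using smooth_fun_mult[OF smooth_fun_const[of "-1"] h(1)] by simp
    moreover have "\<forall>\<^sub>F w in nhds (?c s). - h w = - H w" using h(2) by simp
    moreover have "((\<lambda>s. f (?c s)) has_real_derivative pb (\<lambda>w. - h w) f (?c s)) (at s)"
      if f: "smooth_fun atl f" for f
    proof -
      have "((\<lambda>s. t - s) has_real_derivative - 1) (at s)" by (auto intro!: derivative_eq_intros)
      from DERIV_chain2[where f="\<lambda>s. f (c s)", OF h(3)[OF f] this] show ?thesis
        by (simp add: pb_uminus_left[OF h(1) f])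
    qed
    ultimately show "\<exists>h. smooth_fun atl h \<and> (\<forall>\<^sub>F w in nhds (?c s). h w = - H w) \<and>
        (\<forall>f. smooth_fun atl f \<longrightarrow> ((\<lambda>s. f (?c s)) has_real_derivative pb h f (?c s)) (at s))"
      by blast
  qed
  ultimately show ?thesis
    unfolding flows_to_def using 1 by (intro exI[of _ ?I] exI[of _ ?c]) auto
qed

section \<open>First class constraints\<close>

lemma smooth_fun_constraint_comb:
  "(\<And>i. smooth_fun atl (C i)) \<Longrightarrow> smooth_fun atl (constraint_comb \<gamma> C)"
  unfolding constraint_comb_def[abs_def]
  by (intro smooth_fun_sum smooth_fun_mult smooth_fun_const)

text \<open>By first-classness the values of the constraints along the curve solve a homogeneous
  linear system with zero initial data, so they stay zero by Gronwall.\<close>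

lemma constraint_surface_flow:
  fixes C :: "'n::finite \<Rightarrow> 'm \<Rightarrow> real"
  assumes C: "\<And>i. smooth_fun atl (C i)" and fc: "first_class atl pb C"
    and flow: "flows_to atl pb (constraint_comb \<gamma> C) t y z" and y: "y \<in> constraint_surface C"
  shows "z \<in> constraint_surface C"
proof -
  obtain I c where I: "is_interval I" "0 \<in> I" "t \<in> I"
    and c: "integral_curve atl pb (constraint_comb \<gamma> C) I c" "c 0 = y" "c t = z"
    using flow by (auto simp: flows_to_def)
  obtain F where F: "\<And>i j k. smooth_fun atl (F i j k)"
    "\<And>i j y. pb (C i) (C j) y = (\<Sum>k\<in>UNIV. F i j k y * C k y)"
    using fc unfolding first_class_def by metis
  have H: "smooth_fun atl (constraint_comb \<gamma> C)"
    by (rule smooth_fun_constraint_comb[OF C])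
  \<comment> \<open>The coefficients of that linear system, assembled from the structure functions
    \<open>F\<close>.\<close>
  define a where "a i k s = (\<Sum>j\<in>UNIV. \<gamma> $ j * F j i k (c s))" for i k s
  have deriv: "((\<lambda>s. f (c s)) has_real_derivative pb (constraint_comb \<gamma> C) f (c s)) (at s)"
    if "s \<in> I" "smooth_fun atl f" for s f
    by (rule integral_curve_deriv[OF c(1) that(1) H that(2)]) simp
  have pbC: "pb (constraint_comb \<gamma> C) (C i) (c s) = (\<Sum>k\<in>UNIV. a i k s * C k (c s))" for i s
  proof -
    have "pb (\<lambda>z. \<gamma> $ j * C j z) (C i) (c s) = \<gamma> $ j * pb (C j) (C i) (c s)" for j
      using pb_comb_left[OF C C C, of "\<gamma> $ j" j 0 j i "c s"] by simp
    then have "pb (constraint_comb \<gamma> C) (C i) (c s) = (\<Sum>j\<in>UNIV. \<gamma> $ j * pb (C j) (C i) (c s))"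
      unfolding constraint_comb_def[abs_def]
      by (subst pb_sum_left) (auto intro!: smooth_fun_mult smooth_fun_const C)
    also have "\<dots> = (\<Sum>j\<in>UNIV. \<Sum>k\<in>UNIV. \<gamma> $ j * F j i k (c s) * C k (c s))"
      by (simp add: F(2) sum_distrib_left mult.assoc)
    also have "\<dots> = (\<Sum>k\<in>UNIV. a i k s * C k (c s))"
      by (subst sum.swap) (simp add: a_def sum_distrib_right)
    finally show ?thesis .
  qed
  \<comment> \<open>A compact interval, also for negative \<open>t\<close>. The coefficients are
    continuous on it, because smooth functions are differentiable along the curve, and hence
    bounded.\<close>
  define J where "J = closed_segment 0 t"
  have J: "J \<subseteq> I"
    unfolding J_def using I by (intro closed_segment_subset) (simp_all add: is_interval_convex_1)
  have "\<exists>M. \<forall>s\<in>J. \<bar>a i k s\<bar> \<le> M" for i k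
  proof -
    have "continuous_on J (a i k)"
      unfolding a_def[abs_def]
      by (intro continuous_on_sum continuous_on_mult continuous_on_const
          continuous_at_imp_continuous_on ballI DERIV_isCont[OF deriv] F) (use J in auto)
    then have "bounded (a i k ` J)"
      by (intro compact_imp_bounded compact_continuous_image) (auto simp: J_def)
    then show ?thesis by (auto simp: bounded_iff)
  qed
  then obtain M where M: "\<And>i k s. s \<in> J \<Longrightarrow> \<bar>a i k s\<bar> \<le> M i k" by metis
  define L where "L = (\<Sum>i\<in>UNIV. \<Sum>k\<in>UNIV. \<bar>M i k\<bar>)"
  have L: "\<bar>a i k s\<bar> \<le> L" if "s \<in> J" for i k s
  proof -
    have "\<bar>a i k s\<bar> \<le> \<bar>M i k\<bar>" using M[OF that, of i k] by simp
    also have "\<dots> \<le> (\<Sum>k\<in>UNIV. \<bar>M i k\<bar>)" by (rule member_le_sum) auto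
    also have "\<dots> \<le> L" unfolding L_def by (rule member_le_sum) (auto intro: sum_nonneg)
    finally show ?thesis .
  qed
  have "C i (c t) = 0" for i
  proof (rule gronwall_zero_system[where A=UNIV and J=J and ?t0.0=0 and u="\<lambda>i s. C i (c s)"
        and u'="\<lambda>i s. pb (constraint_comb \<gamma> C) (C i) (c s)" and L=L])
    fix i s assume s: "s \<in> J"
    then show "((\<lambda>s. C i (c s)) has_real_derivative pb (constraint_comb \<gamma> C) (C i) (c s)) (at s)"
      using deriv C J by blast
    have "\<bar>\<Sum>k\<in>UNIV. a i k s * C k (c s)\<bar> \<le> (\<Sum>k\<in>UNIV. L * \<bar>C k (c s)\<bar>)"
      by (rule order_trans[OF sum_abs]) (auto intro!: sum_mono mult_right_mono L[OF s] simp: abs_mult)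
    then show "\<bar>pb (constraint_comb \<gamma> C) (C i) (c s)\<bar> \<le> L * (\<Sum>k\<in>UNIV. \<bar>C k (c s)\<bar>)"
      by (simp add: pbC sum_distrib_left)
  qed (use y c in \<open>auto simp: J_def constraint_surface_def is_interval_convex_1\<close>)
  then show ?thesis using c by (simp add: constraint_surface_def)
qed

lemma gauge_orbit_subset_constraint_surface:
  assumes "\<And>i. smooth_fun atl (C i)" "first_class atl pb C" "x \<in> constraint_surface C"
  shows "gauge_orbit atl pb C x \<subseteq> constraint_surface C"
proof
  fix y assume "y \<in> gauge_orbit atl pb C x"
  then show "y \<in> constraint_surface C"
    by induction (use assms constraint_surface_flow in blast)+
qed

section \<open>The modified constraints and their action on the clocks\<close>

lemma smooth_fun_det:
  fixes M :: "'m \<Rightarrow> real^'n^'n"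
  assumes "\<And>i j. smooth_fun atl (\<lambda>z. M z $ i $ j)"
  shows "smooth_fun atl (\<lambda>z. det (M z))"
  unfolding det_def
  by (intro smooth_fun_sum smooth_fun_mult smooth_fun_prod smooth_fun_const assms)

text \<open>
  The coefficients \<open>w = \<gamma> A\<^sup>-\<^sup>1\<close> of the generator \<open>\<Sum>\<^sub>j w\<^sub>j C\<^sub>j\<close> need not be smooth on the whole manifold, but
  by Cramer's rule \<open>det A \<cdot> w\<^sub>j\<close> is polynomial in \<open>\<gamma>\<close> and the entries of \<open>A\<close>. So the Leibniz rule is
  applied to \<open>det A \<cdot> h\<close>.
\<close>

lemma pb_modified_constraint_clock:
  fixes C T :: "'n::finite \<Rightarrow> 'm \<Rightarrow> real"
  assumes C: "\<And>i. smooth_fun atl (C i)" and T: "\<And>i. smooth_fun atl (T i)"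
    and U: "open U" "y \<in> U" "\<And>z. z \<in> U \<Longrightarrow> invertible (clock_matrix pb C T z)"
    and y: "y \<in> constraint_surface C"
    and h: "smooth_fun atl h"
      "\<forall>\<^sub>F z in nhds y. h z = constraint_comb \<gamma> (modified_constraint pb C T) z"
  shows "pb h (T i) y = \<gamma> $ i"
proof -
  \<comment> \<open>Transposed, so that the row vector \<open>w\<close> solves the column system
    \<open>A z *v w z = \<gamma>\<close>, the form in which Cramer's rule applies.\<close>
  define A where "A z = transpose (clock_matrix pb C T z)" for z
  define D where "D z = det (A z)" for z
  \<comment> \<open>Column \<open>k\<close> is replaced by \<open>\<gamma>\<close>, so
    \<open>m k\<close> is the numerator in Cramer's rule; unlike \<open>w\<close> it is smooth on
    the whole manifold.\<close>
  define B where "B k z = (\<chi> i j. if j = k then \<gamma> $ i else A z $ i $ j)" for k z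
  define m where "m k z = det (B k z)" for k z
  define w where "w z = \<gamma> v* matrix_inv (clock_matrix pb C T z)" for z
  have A: "smooth_fun atl (\<lambda>z. A z $ i $ j)" for i j
    using smooth_fun_pb[OF C T] by (simp add: A_def transpose_def clock_matrix_def)
  have D: "smooth_fun atl D"
    unfolding D_def[abs_def] by (intro smooth_fun_det A)
  have m: "smooth_fun atl (m k)" for k
    unfolding m_def[abs_def]
  proof (rule smooth_fun_det)
    show "smooth_fun atl (\<lambda>z. B k z $ i $ j)" for i j
      using A smooth_fun_const by (cases "j = k") (simp_all add: B_def)
  qed
  have Aw: "A z *v w z = \<gamma>" if "z \<in> U" for z
  proof -
    have "A z *v w z = (\<gamma> v* matrix_inv (clock_matrix pb C T z)) v* clock_matrix pb C T z"
      by (simp add: A_def w_def)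
    also have "\<dots> = \<gamma> v* (matrix_inv (clock_matrix pb C T z) ** clock_matrix pb C T z)"
      by (rule vector_matrix_mul_assoc)
    \<comment> \<open>\<open>matrix_inv\<close> is a choice, which invertibility on \<open>U\<close>
      guarantees to be an inverse.\<close>
    also have "matrix_inv (clock_matrix pb C T z) ** clock_matrix pb C T z = mat 1"
      unfolding matrix_inv_def using U(3)[OF that, unfolded invertible_def]
      by (rule someI2_ex) blast
    finally show ?thesis by simp
  qed
  have mw: "m k z = w z $ k * D z" if "z \<in> U" for k z
    using cramer_lemma[of k "A z" "w z", unfolded Aw[OF that]] by (simp add: m_def B_def D_def)
  have comb: "constraint_comb \<gamma> (modified_constraint pb C T) z = (\<Sum>j\<in>UNIV. w z $ j * C j z)" for z
  proof -
    have "constraint_comb \<gamma> (modified_constraint pb C T) z =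
        (\<Sum>m\<in>UNIV. \<Sum>j\<in>UNIV. \<gamma> $ m * matrix_inv (clock_matrix pb C T z) $ m $ j * C j z)"
      by (simp add: constraint_comb_def modified_constraint_def sum_distrib_left mult.assoc)
    also have "\<dots> = (\<Sum>j\<in>UNIV. w z $ j * C j z)"
      by (subst sum.swap) (simp add: w_def vector_matrix_mult_def sum_distrib_right)
    finally show ?thesis .
  qed
  \<comment> \<open>Both \<open>C j\<close> and \<open>h\<close> vanish at \<open>y\<close>, which
    removes the Leibniz terms in which \<open>m j\<close> or \<open>D\<close> is
    differentiated.\<close>
  have C0: "C j y = 0" for j using y by (simp add: constraint_surface_def)
  have "h y = constraint_comb \<gamma> (modified_constraint pb C T) y"
    using h(2) by (rule eventually_nhds_x_imp_x)
  then have h0: "h y = 0" by (simp add: comb C0)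
  have "\<forall>\<^sub>F z in nhds y. z \<in> U" using U by (simp add: eventually_nhds_in_open)
  with h(2) have eq: "\<forall>\<^sub>F z in nhds y. D z * h z = (\<Sum>j\<in>UNIV. m j z * C j z)"
    by eventually_elim (simp add: comb mw sum_distrib_left mult_ac)
  have "D y * pb h (T i) y = pb (\<lambda>z. D z * h z) (T i) y"
    using pb_mult_left[OF D h(1) T] h0 by simp
  also have "\<dots> = pb (\<lambda>z. \<Sum>j\<in>UNIV. m j z * C j z) (T i) y"
    \<comment> \<open>The two generators agree only near \<open>y\<close>; locality of the bracket
      suffices.\<close>
    by (rule pb_cong_left[OF _ _ _ eq]) (intro smooth_fun_mult smooth_fun_sum D h m C T)+
  also have "\<dots> = (\<Sum>j\<in>UNIV. pb (\<lambda>z. m j z * C j z) (T i) y)"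
    by (rule pb_sum_left) (auto intro: smooth_fun_mult m C T)
  also have "\<dots> = (\<Sum>j\<in>UNIV. m j y * pb (C j) (T i) y)"
    by (simp add: pb_mult_left[OF m C T] C0)
  also have "\<dots> = D y * (A y *v w y) $ i"
    by (simp add: mw[OF U(2)] A_def transpose_def clock_matrix_def matrix_vector_mult_def
        sum_distrib_left mult_ac)
  also have "\<dots> = D y * \<gamma> $ i" by (simp add: Aw[OF U(2)])
  finally show ?thesis
    using U(3)[OF U(2)] by (simp add: D_def A_def invertible_det_nz)
qed

text \<open>Along the flow each clock has the constant derivative \<open>\<gamma> $ i\<close>, and
  the mean value theorem integrates it over the unit time interval.\<close>

lemma clock_shift_modified_flow:
  fixes C T :: "'n::finite \<Rightarrow> 'm \<Rightarrow> real"
  assumes C: "\<And>i. smooth_fun atl (C i)" and T: "\<And>i. smooth_fun atl (T i)"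
    and U: "open U" "constraint_surface C \<subseteq> U" "\<And>z. z \<in> U \<Longrightarrow> invertible (clock_matrix pb C T z)"
    and orbit: "gauge_orbit atl pb (modified_constraint pb C T) y \<subseteq> constraint_surface C"
    and flow: "flows_to atl pb (constraint_comb \<gamma> (modified_constraint pb C T)) 1 y z"
  shows "T i z = T i y + \<gamma> $ i"
proof -
  let ?H = "constraint_comb \<gamma> (modified_constraint pb C T)"
  obtain I c where I: "open I" "is_interval I" "0 \<in> I" "1 \<in> I"
    and c: "integral_curve atl pb ?H I c" "c 0 = y" "c 1 = z"
    using flow by (auto simp: flows_to_def)
  \<comment> \<open>Each intermediate point is itself reached by a flow of the modified constraints,
    so it belongs to their orbit and hence to the surface, where the bracket with the clocks is
    known.\<close>
  have surf: "c s \<in> constraint_surface C" if "s \<in> I" for s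
  proof -
    have "flows_to atl pb ?H s y (c s)"
      unfolding flows_to_def using I c that by blast
    then show ?thesis using orbit gauge_orbit.flow[OF gauge_orbit.start] by blast
  qed
  have deriv: "((\<lambda>s. T i (c s)) has_real_derivative \<gamma> $ i) (at s)" if s: "s \<in> I" for s
  proof -
    obtain h where h: "smooth_fun atl h" "\<forall>\<^sub>F w in nhds (c s). h w = ?H w"
      "((\<lambda>s. T i (c s)) has_real_derivative pb h (T i) (c s)) (at s)"
      using c(1) s T unfolding integral_curve_def by blast
    have "pb h (T i) (c s) = \<gamma> $ i"
      by (rule pb_modified_constraint_clock[OF C T U(1) _ U(3) surf[OF s] h(1,2)])
        (use surf[OF s] U(2) in auto)
    then show ?thesis using h(3) by simp
  qed
  have "((\<lambda>s. T i (c s)) has_real_derivative \<gamma> $ i) (at s)" if "0 \<le> s" "s \<le> 1" for s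
    using that by (intro deriv mem_is_interval_1_I[OF I(2-4)])
  from MVT2[OF zero_less_one this] have "T i (c 1) - T i (c 0) = \<gamma> $ i" by auto
  then show ?thesis using c by simp
qed

section \<open>Complete observables\<close>

text \<open>Uniqueness is a premise because for the flowed clocks it is obtained by transport along
  the flow, while for the original clocks it comes from injectivity.\<close>

lemma complete_observable_eq:
  assumes "z \<in> gauge_orbit atl pb C x" "\<And>i. T i z = \<tau> $ i"
    and "\<And>w. w \<in> gauge_orbit atl pb C x \<Longrightarrow> (\<And>i. T i w = \<tau> $ i) \<Longrightarrow> w = z"
  shows "complete_observable_defined atl pb C T \<tau> x" "complete_observable atl pb C f T \<tau> x = f z"
proof -
  show "complete_observable_defined atl pb C T \<tau> x"
    unfolding complete_observable_defined_def by (rule ex1I[of _ z]) (use assms in blast)+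
  have "(THE z. z \<in> gauge_orbit atl pb C x \<and> (\<forall>i. T i z = \<tau> $ i)) = z"
    by (rule the_equality) (use assms in blast)+
  then show "complete_observable atl pb C f T \<tau> x = f z"
    by (simp add: complete_observable_def)
qed

lemma complete_observable_eq_inj:
  assumes inj: "inj_on (clock_map T) (gauge_orbit atl pb C x)"
    and z: "z \<in> gauge_orbit atl pb C x" "\<And>i. T i z = \<tau> $ i"
  shows "complete_observable_defined atl pb C T \<tau> x" "complete_observable atl pb C f T \<tau> x = f z"
proof -
  have "w = z" if "w \<in> gauge_orbit atl pb C x" "\<And>i. T i w = \<tau> $ i" for w
    using inj_onD[OF inj _ that(1) z(1)] that(2) z(2) by (simp add: clock_map_def)
  then show "complete_observable_defined atl pb C T \<tau> x" "complete_observable atl pb C f T \<tau> x = f z"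
    using complete_observable_eq[where T=T and \<tau>=\<tau>, OF z] by blast+
qed

end

section \<open>Assembly of the two observable identities\<close>

lemma constraint_comb_uminus: "constraint_comb (- \<gamma>) C = (\<lambda>z. - constraint_comb \<gamma> C z)"
  by (simp add: constraint_comb_def fun_eq_iff sum_negf)

theorem mainTheorem9:
  fixes atl :: "('m::{t2_space, second_countable_topology}, 'e::euclidean_space) chart set"
    and pb :: "'m bracket"
    and C T :: "'n::finite \<Rightarrow> 'm \<Rightarrow> real"
    and f :: "'m \<Rightarrow> real"
    and x :: 'm
    and \<tau> \<gamma> :: "real^'n"
    and p :: nat
  assumes manifold: "smooth_atlas atl" "DIM('e) = 2 * p"
    and poisson: "poisson_bracket atl pb" "nondegenerate atl pb"
    and number: "CARD('n) < p"
    and constraints_smooth: "\<And>i. smooth_fun atl (C i)"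
    and independent: "independent_constraints atl C"
    and first_class: "first_class atl pb C"
    and clocks_smooth: "\<And>i. smooth_fun atl (T i)"
    and f_smooth: "smooth_fun atl f"
    and x: "x \<in> constraint_surface C"
    and clocks_inj: "inj_on (clock_map T) (gauge_orbit atl pb C x)"
    and \<tau>: "\<tau> \<in> clock_map T ` gauge_orbit atl pb C x"
  shows
    "((\<forall>y\<in>gauge_orbit atl pb C x.
         flow_defined atl pb (constraint_comb \<gamma> C) 1 y \<and>
         flow_defined atl pb (constraint_comb (- \<gamma>) C) 1 y) \<longrightarrow>
      (let \<alpha>T = (\<lambda>i. flow_act atl pb (constraint_comb (- \<gamma>) C) (T i));
           \<tau>' = (\<chi> i. T i (ham_flow atl pb (constraint_comb \<gamma> C) 1
                              (clock_map_inv atl pb C T x \<tau>)))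
       in complete_observable_defined atl pb C T \<tau> x \<and>
          complete_observable_defined atl pb C \<alpha>T \<tau> x \<and>
          complete_observable_defined atl pb C T \<tau>' x \<and>
          complete_observable atl pb C (flow_act atl pb (constraint_comb \<gamma> C) f) T \<tau> x
            = complete_observable atl pb C f \<alpha>T \<tau> x \<and>
          complete_observable atl pb C f \<alpha>T \<tau> x
            = complete_observable atl pb C f T \<tau>' x))
   \<and>
     (let C' = modified_constraint pb C T
      in (\<exists>U. open U \<and> constraint_surface C \<subseteq> U \<and> (\<forall>y\<in>U. invertible (clock_matrix pb C T y))) \<and>
         (\<forall>y\<in>constraint_surface C. gauge_orbit atl pb C' y = gauge_orbit atl pb C y) \<and>
         (\<forall>y\<in>gauge_orbit atl pb C x. flow_defined atl pb (constraint_comb \<gamma> C') 1 y) \<longrightarrow>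
         complete_observable_defined atl pb C T \<tau> x \<and>
         complete_observable_defined atl pb C T (\<tau> + \<gamma>) x \<and>
         complete_observable atl pb C (flow_act atl pb (constraint_comb \<gamma> C') f) T \<tau> x
           = complete_observable atl pb C f T (\<tau> + \<gamma>) x)"
proof -
  interpret poisson_manifold atl pb
    by unfold_locales (fact manifold(1), fact poisson(1))
  let ?O = "gauge_orbit atl pb C x"
  obtain z where z: "z \<in> ?O" "clock_map T z = \<tau>" using \<tau> by blast
  have Tz: "T i z = \<tau> $ i" for i using z(2) by (auto simp: clock_map_def)
  note obs_z = complete_observable_eq_inj[where T=T and \<tau>=\<tau>, OF clocks_inj z(1) Tz]
  \<comment> \<open>The constraint family \<open>D\<close> is kept general, to serve both the
    original and the modified constraints.\<close>
  have flow_mem: "ham_flow atl pb (constraint_comb \<beta> D) 1 y \<in> gauge_orbit atl pb D x \<and>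
      flows_to atl pb (constraint_comb \<beta> D) 1 y (ham_flow atl pb (constraint_comb \<beta> D) 1 y)"
    if "y \<in> gauge_orbit atl pb D x" "flow_defined atl pb (constraint_comb \<beta> D) 1 y"
    for \<beta> :: "real^'n" and D y
    using that ham_flow_eq gauge_orbit.flow unfolding flow_defined_def by metis
  show ?thesis
    unfolding Let_def
  proof (intro conjI[of "_ \<longrightarrow> _" "_ \<longrightarrow> _"] impI)
    let ?\<alpha> = "ham_flow atl pb (constraint_comb \<gamma> C) 1"
    let ?\<beta> = "ham_flow atl pb (constraint_comb (- \<gamma>) C) 1"
    let ?aT = "\<lambda>i. flow_act atl pb (constraint_comb (- \<gamma>) C) (T i)"
    let ?\<tau>' = "\<chi> i. T i (?\<alpha> (clock_map_inv atl pb C T x \<tau>))"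
    assume defd: "\<forall>y\<in>?O. flow_defined atl pb (constraint_comb \<gamma> C) 1 y \<and>
         flow_defined atl pb (constraint_comb (- \<gamma>) C) 1 y"
    \<comment> \<open>The flow of the negated combination runs the same curve backwards, so the two
      maps are mutually inverse permutations of the orbit.\<close>
    have \<alpha>: "?\<alpha> y \<in> ?O" "?\<beta> (?\<alpha> y) = y" if "y \<in> ?O" for y
      using flow_mem[of y C \<gamma>] that defd flows_to_reverse ham_flow_eq
      unfolding constraint_comb_uminus by blast+
    have \<beta>: "?\<beta> y \<in> ?O" "?\<alpha> (?\<beta> y) = y" if "y \<in> ?O" for y
      using flow_mem[of y C "- \<gamma>"] that defd flows_to_reverse[of "constraint_comb (- \<gamma>) C"]
        ham_flow_eq constraint_comb_uminus[of "- \<gamma>" C]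
      by (auto simp: fun_eq_iff[symmetric])
    have inv: "clock_map_inv atl pb C T x \<tau> = z"
      unfolding clock_map_inv_def
      by (rule the_equality) (use z inj_onD[OF clocks_inj] in blast)+
    \<comment> \<open>If the flowed clocks take the value \<open>\<tau>\<close> at \<open>w\<close>,
      then the original clocks take it at \<open>?\<beta> w\<close>; injectivity gives
      \<open>?\<beta> w = z\<close>, and applying \<open>?\<alpha>\<close> recovers
      \<open>w\<close>.\<close>
    have uniq: "w = ?\<alpha> z" if "w \<in> ?O" "\<And>i. ?aT i w = \<tau> $ i" for w
    proof -
      have "?\<beta> w = z"
        using that \<beta>(1) inj_onD[OF clocks_inj _ _ z(1)] Tz
        by (simp add: flow_act_def clock_map_def)
      then show ?thesis using \<beta>(2)[OF that(1)] by simp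
    qed
    note obs_aT = complete_observable_eq[where T="?aT" and \<tau>=\<tau>, OF \<alpha>(1)[OF z(1)] _ uniq]
    have aT: "?aT i (?\<alpha> z) = \<tau> $ i" for i
      by (simp add: flow_act_def \<alpha>(2)[OF z(1)] Tz)
    have \<tau>': "T i (?\<alpha> z) = ?\<tau>' $ i" for i by (simp add: inv)
    note obs_\<tau>' = complete_observable_eq_inj[where T=T and \<tau>="?\<tau>'", OF clocks_inj \<alpha>(1)[OF z(1)] \<tau>']
    show "complete_observable_defined atl pb C T \<tau> x \<and>
          complete_observable_defined atl pb C ?aT \<tau> x \<and>
          complete_observable_defined atl pb C T ?\<tau>' x \<and>
          complete_observable atl pb C (flow_act atl pb (constraint_comb \<gamma> C) f) T \<tau> x
            = complete_observable atl pb C f ?aT \<tau> x \<and>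
          complete_observable atl pb C f ?aT \<tau> x = complete_observable atl pb C f T ?\<tau>' x"
      \<comment> \<open>All three observables evaluate to \<open>f (?\<alpha> z)\<close>.\<close>
      using obs_z obs_aT[OF aT] obs_\<tau>' by (simp add: flow_act_def)
  next
    let ?C' = "modified_constraint pb C T"
    let ?\<alpha> = "ham_flow atl pb (constraint_comb \<gamma> ?C') 1"
    assume *: "(\<exists>U. open U \<and> constraint_surface C \<subseteq> U \<and> (\<forall>y\<in>U. invertible (clock_matrix pb C T y))) \<and>
         (\<forall>y\<in>constraint_surface C. gauge_orbit atl pb ?C' y = gauge_orbit atl pb C y) \<and>
         (\<forall>y\<in>?O. flow_defined atl pb (constraint_comb \<gamma> ?C') 1 y)"
    then obtain U where U: "open U" "constraint_surface C \<subseteq> U"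
      "\<And>y. y \<in> U \<Longrightarrow> invertible (clock_matrix pb C T y)" by blast
    have orbit: "gauge_orbit atl pb ?C' y = gauge_orbit atl pb C y" if "y \<in> constraint_surface C" for y
      using * that by blast
    note surf = gauge_orbit_subset_constraint_surface[OF constraints_smooth first_class]
    have zs: "z \<in> constraint_surface C" using surf[OF x] z(1) by blast
    have flow: "?\<alpha> z \<in> ?O" "flows_to atl pb (constraint_comb \<gamma> ?C') 1 z (?\<alpha> z)"
      using flow_mem[of z ?C' \<gamma>] orbit[OF x] z(1) * by auto
    \<comment> \<open>The modified flow starts at \<open>z\<close>, so the agreement of the two
      kinds of orbit is used at \<open>z\<close>, which lies on the constraint surface.\<close>
    have T\<alpha>: "T i (?\<alpha> z) = (\<tau> + \<gamma>) $ i" for i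
      using clock_shift_modified_flow[OF constraints_smooth clocks_smooth U _ flow(2), of i]
        surf[OF zs] orbit[OF zs] Tz by simp
    note obs = complete_observable_eq_inj[where T=T and \<tau>="\<tau> + \<gamma>", OF clocks_inj flow(1) T\<alpha>]
    show "complete_observable_defined atl pb C T \<tau> x \<and>
         complete_observable_defined atl pb C T (\<tau> + \<gamma>) x \<and>
         complete_observable atl pb C (flow_act atl pb (constraint_comb \<gamma> ?C') f) T \<tau> x
           = complete_observable atl pb C f T (\<tau> + \<gamma>) x"
      using obs_z obs by (simp add: flow_act_def)
  qed
qed

end
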